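(* Let $q=p^e>4$, where $p$ is a prime, and let $\ell$ be a positive integer with $2\ell\mid e$. Let $\boldsymbol a=(a_1,\ldots,a_n)$ consist of distinct elements of $\mathbb F_q$, put $u_j=\prod_{v\ne j}(a_j-a_v)^{-1}$, and let $2\le s<k\le n$. The following statements hold. (1) Assume that $a_j\ne0$ and $a_j^{-1}u_j\in\mathbb F_{p^\ell}^*$ for $1\le j\le n$. For every $s<k\le\left\lfloor\frac{n+p^\ell}{p^\ell+1}\right\rfloor$ and every $0\le h\le k-s-1$, there exists an $[[n+s,k-h,d;n+s-k-h]]_q$ EAQECC with $d\ge n-k+2$. (2) Let $\delta\in\mathbb Z_{>0}$ and $\lambda\in\mathbb F_q^*$, and assume that $\lambda a_j^{\delta-1}u_j\in\mathbb F_{p^\ell}^*$ for $1\le j\le n$. For every $s<k\le\left\lfloor\frac{n+p^\ell-\delta+1}{p^\ell+1}\right\rfloor$ and every $0\le h\le k-s$, there exists an $[[n+s,k-h,d;n+s-k-h]]_q$ EAQECC with $d\ge n-k+2$. (3) Assume that $a_j\ne0$ and $a_j^{-1}u_j\in\mathbb F_{p^\ell}^*$ for $1\le j\le n$, and that $n/(p^\ell+1)\in\mathbb Z_{>0}$. If $k=\xi+1+n/(p^\ell+1)$, $0\le \xi\le\min\{p^\ell-1,\lfloor(n/(p^\ell+1)-1)/p^\ell\rfloor\}$ and $\xi+1\le s\le\min\{\xi+p^\ell,k-1\}$, there exists an $[[n+s,s,d;n-2k+2s]]_q$ EAQECC with $d\ge n-k+2$. (4) Let $\delta\in\mathbb Z_{>0}$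 and $\lambda\in\mathbb F_{p^\ell}^*$, and assume that $\lambda a_j^{\delta-1}u_j\in\mathbb F_{p^\ell}^*$ for $1\le j\le n$. Suppose that $(n-\delta)/(p^\ell+1)\in\mathbb Z_{>0}$. If $k=\xi+1+(n-\delta)/(p^\ell+1)$, $0\le \xi\le\min\{p^\ell-1,\lfloor(n-\delta)/(p^\ell(p^\ell+1))\rfloor\}$ and $\xi+1\le s\le\min\{\xi+p^\ell,k-1\}$, there exists an $[[n+s,s-1,d;n-2k+2s-1]]_q$ EAQECC with $d\ge n-k+2$.
   Context: A $q$-ary entanglement-assisted quantum error-correcting code (EAQECC) with parameters $[[N,K,d;c]]_q$ encodes $K$ logical qudits (each with state space $\mathbb C^q$) into $N$ physical qudits with the assistance of $c$ maximally entangled pairs shared in advance between sender and receiver, and has minimum distance $d$. Concretely: there is a unitary $U$ on $(\mathbb C^q)^{\otimes N}$ such that the code space is the image of $|\psi\rangle\mapsto(U\otimes I)\bigl(|\psi\rangle\otimes|0\rangle^{\otimes(N-K-c)}\otimes|\Phi\rangle^{\otimes c}\bigr)$, $|\psi\rangle\in(\mathbb C^q)^{\otimes K}$, where $|\Phi\rangle=q^{-1/2}\sum_{i}|i\rangle|i\rangle$, $U$ acts on the $K$ logical qudits, the $N-K-c$ ancillas and the sender's halves of the $c$ pairs, and $I$ acts on the receiver's halves, which are error-free. An error $E$ on the $N$ transmitted qudits is detected if $P(E\otimes I)P=c_EP$ for some scalar $c_E$, where $P$ is the projector onto the code space; minimum distance at least $d$ means that all errors acting nontrivially on at most $d-1$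 of the $N$ transmitted qudits are detected. Convention: $x^0=1$, including $0^0=1$. *)

theory Defs
  imports Complex_Main "HOL-Library.Cardinality" "HOL-Computational_Algebra.Primes"
begin

text \<open>
  The space \<open>(\<complex>\<^sup>q)\<^sup>\<otimes>\<^sup>m\<close> is given in coordinates with respect to the computational basis, whose
  vectors are labelled by the words of length \<open>m\<close> over \<open>{0,\<dots>,q-1}\<close>. A vector is its amplitude
  function and an operator is its matrix; both vanish outside the basis labels, so that
  equality of functions is equality of vectors and of operators. Tensor products correspond to
  concatenation of labels.
\<close>

definition basis_labels :: "nat \<Rightarrow> nat \<Rightarrow> nat list set" where
  "basis_labels q m = {x. set x \<subseteq> {..<q} \<and> length x = m}"

type_synonym qvec = "nat list \<Rightarrow> complex"
type_synonym qop = "nat list \<Rightarrow> nat list \<Rightarrow> complex"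

definition vecs :: "nat \<Rightarrow> nat \<Rightarrow> qvec set" where
  "vecs q m = {\<psi>. \<forall>x. x \<notin> basis_labels q m \<longrightarrow> \<psi> x = 0}"

definition ops :: "nat \<Rightarrow> nat \<Rightarrow> qop set" where
  "ops q m = {A. \<forall>x y. x \<notin> basis_labels q m \<or> y \<notin> basis_labels q m \<longrightarrow> A x y = 0}"

definition op_apply :: "nat \<Rightarrow> nat \<Rightarrow> qop \<Rightarrow> qvec \<Rightarrow> qvec" where
  "op_apply q m A \<psi> = (\<lambda>x. \<Sum>y\<in>basis_labels q m. A x y * \<psi> y)"

definition op_mult :: "nat \<Rightarrow> nat \<Rightarrow> qop \<Rightarrow> qop \<Rightarrow> qop" where
  "op_mult q m A B = (\<lambda>x z. \<Sum>y\<in>basis_labels q m. A x y * B y z)"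

definition op_id :: "nat \<Rightarrow> nat \<Rightarrow> qop" where
  "op_id q m = (\<lambda>x y. if x = y \<and> x \<in> basis_labels q m then 1 else 0)"

definition op_adjoint :: "qop \<Rightarrow> qop" where
  "op_adjoint A = (\<lambda>x y. cnj (A y x))"

definition op_unitary :: "nat \<Rightarrow> nat \<Rightarrow> qop \<Rightarrow> bool" where
  "op_unitary q m U \<longleftrightarrow> U \<in> ops q m \<and>
     op_mult q m (op_adjoint U) U = op_id q m \<and> op_mult q m U (op_adjoint U) = op_id q m"

text \<open>In both tensor products the first argument lives on the first \<open>m\<close> qudits.\<close>

definition vec_tensor :: "nat \<Rightarrow> qvec \<Rightarrow> qvec \<Rightarrow> qvec" where
  "vec_tensor m \<psi> \<phi> = (\<lambda>x. \<psi> (take m x) * \<phi> (drop m x))"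

definition op_tensor :: "nat \<Rightarrow> qop \<Rightarrow> qop \<Rightarrow> qop" where
  "op_tensor m A B = (\<lambda>x y. A (take m x) (take m y) * B (drop m x) (drop m y))"

definition ket :: "nat list \<Rightarrow> qvec" where
  "ket y = (\<lambda>x. if x = y then 1 else 0)"

text \<open>
  The \<open>c\<close>-th tensor power of \<open>q\<^sup>-\<^sup>1\<^sup>/\<^sup>2 \<Sum>\<^sub>i |i\<rangle>|i\<rangle>\<close>, with the tensor factors
  rearranged so that the \<open>c\<close> sender halves precede the \<open>c\<close> receiver halves.
\<close>

definition entangled_pairs :: "nat \<Rightarrow> nat \<Rightarrow> qvec" where
  "entangled_pairs q c =
     (\<lambda>x. \<Sum>i\<in>basis_labels q c. of_real ((1 / sqrt (real q)) ^ c) * ket (i @ i) x)"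

text \<open>
  Qudits are ordered as \<open>K\<close> logical ones, \<open>N - K - c\<close> ancillas, \<open>c\<close> sender halves (these \<open>N\<close> are
  transmitted) and finally \<open>c\<close> receiver halves.
\<close>

definition ea_code_space :: "nat \<Rightarrow> nat \<Rightarrow> nat \<Rightarrow> nat \<Rightarrow> qop \<Rightarrow> qvec set" where
  "ea_code_space q N K c U =
     (\<lambda>\<psi>. op_apply q (N + c) (op_tensor N U (op_id q c))
            (vec_tensor K \<psi>
              (vec_tensor (N - K - c) (ket (replicate (N - K - c) 0)) (entangled_pairs q c)))) `
     vecs q K"

definition projector_onto :: "nat \<Rightarrow> nat \<Rightarrow> qop \<Rightarrow> qvec set \<Rightarrow> bool" where
  "projector_onto q m P C \<longleftrightarrow> P \<in> ops q m \<and> op_adjoint P = P \<and> op_mult q m P P = P \<and>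
     op_apply q m P ` vecs q m = C"

text \<open>\<open>E\<close> is an operator \<open>M\<close> on the qudits at the positions in \<open>S\<close>, tensored with the identity on
  the remaining ones.\<close>

definition acts_only_on :: "nat \<Rightarrow> nat \<Rightarrow> nat set \<Rightarrow> qop \<Rightarrow> bool" where
  "acts_only_on q N S E \<longleftrightarrow> E \<in> ops q N \<and>
     (\<exists>M. \<forall>x\<in>basis_labels q N. \<forall>y\<in>basis_labels q N.
        E x y = (if \<forall>i\<in>{..<N} - S. x ! i = y ! i then M (nths x S) (nths y S) else 0))"

definition detects :: "nat \<Rightarrow> nat \<Rightarrow> nat \<Rightarrow> qop \<Rightarrow> qop \<Rightarrow> bool" where
  "detects q N c P E \<longleftrightarrow>
     (\<exists>z. op_mult q (N + c) P (op_mult q (N + c) (op_tensor N E (op_id q c)) P)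
          = (\<lambda>x y. z * P x y))"

definition min_dist_at_least :: "nat \<Rightarrow> nat \<Rightarrow> nat \<Rightarrow> qop \<Rightarrow> nat \<Rightarrow> bool" where
  "min_dist_at_least q N c P d \<longleftrightarrow>
     (\<forall>S E. S \<subseteq> {..<N} \<and> card S < d \<and> acts_only_on q N S E \<longrightarrow> detects q N c P E)"

text \<open>Existence of an \<open>[[N,K,d;c]]\<^sub>q\<close> code whose minimum distance is exactly \<open>d\<close>.\<close>

definition EAQECC_exists :: "nat \<Rightarrow> nat \<Rightarrow> nat \<Rightarrow> nat \<Rightarrow> nat \<Rightarrow> bool" where
  "EAQECC_exists q N K d c \<longleftrightarrow> K + c \<le> N \<and>
     (\<exists>U P. op_unitary q N U \<and> projector_onto q (N + c) P (ea_code_space q N K c U) \<and>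
        min_dist_at_least q N c P d \<and> \<not> min_dist_at_least q N c P (Suc d))"

definition is_subfield :: "'a::field set \<Rightarrow> bool" where
  "is_subfield F \<longleftrightarrow> 0 \<in> F \<and> 1 \<in> F \<and>
     (\<forall>x\<in>F. \<forall>y\<in>F. x + y \<in> F \<and> x * y \<in> F) \<and> (\<forall>x\<in>F. - x \<in> F \<and> inverse x \<in> F)"

end

theory Submission
  imports Defs "HOL-Library.Function_Algebras" "HOL-Computational_Algebra.Polynomial"
begin

text \<open>
  Let \<open>C\<close> and \<open>D\<close> be additive codes in \<open>\<F>\<^sup>N\<close> with \<open>|C| = q\<^sup>k\<close>, \<open>|D| = q\<^sup>N\<^sup>-\<^sup>k\<close> and
  \<open>|C \<inter> D| = q\<^sup>k\<^sup>-\<^sup>K\<close>, such that \<open>C\<close> has minimum distance \<open>\<ge> d\<close> and \<open>D\<close> projects onto every set of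
  fewer than \<open>d\<close> coordinates (that is, the dual of \<open>D\<close> has minimum distance \<open>\<ge> d\<close>). Put
  \<open>W = C \<inter> D\<close>, index \<open>C/W\<close> by logical words \<open>x\<close> and \<open>D/W\<close> by receiver words \<open>i\<close>, and send
  \<open>|x\<rangle>\<close> to the uniform superposition of all \<open>|y\<rangle>|i\<rangle>\<close> with \<open>y\<close> in the coset
  \<open>r\<^sub>x + t\<^sub>i + W\<close>. Two labels \<open>y\<close>, \<open>y'\<close> with the same \<open>i\<close> differ by an element of \<open>C\<close>, so an error on
  fewer than \<open>d\<close> qudits has no off-diagonal contributions, and since \<open>y\<close> runs over \<open>r\<^sub>x + D\<close>, its
  diagonal contribution does not depend on \<open>x\<close>. Hence such an error is detected.

  For the parameters of the theorem, \<open>C\<close> consists of the words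
  \<open>(z\<^sub>j f(a\<^sub>j))\<^sub>j\<close> extended by the top \<open>s\<close> coefficients of \<open>f\<close>, \<open>deg f < k\<close>, and the dual of \<open>D\<close> is a
  code of the same shape. With \<open>z\<^sub>j = u\<^sub>j p(a\<^sub>j)\<close>, where \<open>p\<close> is a polynomial without roots, the sum
  \<open>\<Sum>\<^sub>j z\<^sub>j f(a\<^sub>j) a\<^sub>j\<^sup>i\<close> is the coefficient of \<open>x\<^sup>n\<^sup>-\<^sup>1\<close> in \<open>x\<^sup>i p f\<close>, and the degree of \<open>p\<close> together
  with the weights on the extension coordinates gives \<open>C \<inter> D\<close> any prescribed dimension.
\<close>

section \<open>Codes spanned by flat vectors\<close>

lemma finite_basis_labels [simp]: "finite (basis_labels q m)"
  unfolding basis_labels_def by (rule finite_lists_length_eq) simp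

lemma card_basis_labels: "card (basis_labels q m) = q ^ m"
  unfolding basis_labels_def using card_lists_length_eq[of "{..<q}" m] by simp

text \<open>
  The unitary is a permutation followed by the reflections that interchange the basis
  vector of one element of each \<open>S y\<close> and the flat vector on \<open>S y\<close>.
\<close>

lemma unitary_with_flat_columns:
  fixes S :: "nat list \<Rightarrow> nat list set"
  assumes Y: "Y \<subseteq> basis_labels q N"
    and S: "\<And>y. y \<in> Y \<Longrightarrow> S y \<subseteq> basis_labels q N"
    and m: "\<And>y. y \<in> Y \<Longrightarrow> card (S y) = m" "0 < m"
    and disj: "\<And>y y'. y \<in> Y \<Longrightarrow> y' \<in> Y \<Longrightarrow> y \<noteq> y' \<Longrightarrow> S y \<inter> S y' = {}"
  shows "\<exists>U. op_unitary q N U \<and>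
    (\<forall>y\<in>Y. \<forall>x. U x y = (if x \<in> S y then of_real (1 / sqrt (real m)) else 0))"
proof -
  define X where "X = basis_labels q N"
  have finX: "finite X" by (simp add: X_def)
  have finY: "finite Y" using Y finX X_def finite_subset by blast
  have finS: "finite (S y)" if "y \<in> Y" for y using S[OF that] finX X_def finite_subset by blast
  have "\<forall>y\<in>Y. \<exists>x. x \<in> S y" using m by (metis card.empty less_not_refl ex_in_conv)
  then obtain t where t: "\<And>y. y \<in> Y \<Longrightarrow> t y \<in> S y" by metis
  have tX: "t ` Y \<subseteq> X" using t S X_def by blast
  have injt: "inj_on t Y" using t disj by (auto simp: inj_on_def) (metis disjoint_iff)
  \<comment> \<open>The complements of \<open>Y\<close> and of its image under \<open>t\<close> have
    equal size, so \<open>t\<close> extends to a permutation \<open>\<sigma>\<close> of all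
    labels.\<close>
  have "card (X - Y) = card (X - t ` Y)"
    using Y tX finX finY card_image[OF injt] by (simp add: card_Diff_subset X_def)
  then obtain g where g: "bij_betw g (X - Y) (X - t ` Y)"
    using finX by (meson finite_Diff finite_same_card_bij)
  define \<sigma> where "\<sigma> x = (if x \<in> Y then t x else g x)" for x
  have "bij_betw \<sigma> Y (t ` Y)" using injt by (simp add: \<sigma>_def bij_betw_def inj_on_def)
  moreover have "bij_betw \<sigma> (X - Y) (X - t ` Y)"
    using g by (subst bij_betw_cong[of _ _ g]) (auto simp: \<sigma>_def)
  ultimately have "bij_betw \<sigma> (Y \<union> (X - Y)) (t ` Y \<union> (X - t ` Y))"
    by (rule bij_betw_combine) auto
  then have \<sigma>: "bij_betw \<sigma> X X" using Y tX X_def by (simp add: Un_absorb1)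
  define \<alpha> where "\<alpha> = 1 / sqrt (real m)"
  have \<alpha>: "\<alpha> > 0" "\<alpha> * \<alpha> * real m = 1" using m(2) by (auto simp: \<alpha>_def)
  \<comment> \<open>\<open>v y\<close> is the sum of two unit vectors with inner product
    \<open>\<alpha>\<close>: the flat vector on \<open>S y\<close> and the basis vector at
    \<open>t y\<close>. Its squared norm is \<open>2 * (1 + \<alpha>)\<close>, so \<open>G\<close>
    is twice the projection onto the span of the mutually orthogonal \<open>v y\<close>.
    \<open>R\<close> is the reflection fixing that span, and it swaps the two vectors of each
    pair.\<close>
  define v where "v y x = \<alpha> * of_bool (x \<in> S y) + of_bool (x = t y)" for y x
  define G where "G a b = (\<Sum>y\<in>Y. v y a * v y b / (1 + \<alpha>))" for a b
  define R where "R a b = G a b - of_bool (a = b)" for a b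
  have v0: "v y x = 0" if "y \<in> Y" "x \<notin> S y" for y x using that t by (auto simp: v_def)
  have vv: "(\<Sum>x\<in>X. v y x * v y' x) = (if y = y' then 2 * (1 + \<alpha>) else 0)" if y: "y \<in> Y" "y' \<in> Y" for y y'
  proof (cases "y = y'")
    case True
    have "(\<Sum>x\<in>X. v y x * v y x) = (\<Sum>x\<in>S y. v y x * v y x)"
      using S[OF y(1)] finX v0[OF y(1)] by (intro sum.mono_neutral_right) (auto simp: X_def)
    also have "\<dots> = (\<Sum>x\<in>S y. \<alpha> * \<alpha> + (if x = t y then 2 * \<alpha> + 1 else 0))"
      by (rule sum.cong) (auto simp: v_def algebra_simps)
    also have "\<dots> = real m * (\<alpha> * \<alpha>) + (2 * \<alpha> + 1)"
      using finS[OF y(1)] t[OF y(1)] m(1)[OF y(1)] by (simp add: sum.distrib)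
    also have "\<dots> = 2 * (1 + \<alpha>)" using \<alpha>(2) by (simp add: algebra_simps)
    finally show ?thesis using True by simp
  next
    case False
    then have "v y x * v y' x = 0" for x
      using disj[OF y False] v0 y by (metis IntI empty_iff mult_eq_0_iff)
    then have "(\<Sum>x\<in>X. v y x * v y' x) = 0" by (intro sum.neutral) blast
    then show ?thesis using False by simp
  qed
  \<comment> \<open>Twice a projection squares to twice itself; together with symmetry this makes
    \<open>R\<close> an orthogonal involution.\<close>
  have GG: "(\<Sum>b\<in>X. G a b * G b a') = 2 * G a a'" for a a'
  proof -
    have "(\<Sum>b\<in>X. G a b * G b a')
        = (\<Sum>b\<in>X. \<Sum>y\<in>Y. \<Sum>y'\<in>Y. v y a * v y' a' / (1 + \<alpha>)^2 * (v y b * v y' b))"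
      unfolding G_def sum_product by (intro sum.cong refl) (simp add: power2_eq_square)
    also have "\<dots> = (\<Sum>y\<in>Y. \<Sum>y'\<in>Y. \<Sum>b\<in>X. v y a * v y' a' / (1 + \<alpha>)^2 * (v y b * v y' b))"
      by (subst sum.swap) (rule sum.cong[OF refl], rule sum.swap)
    also have "\<dots> = (\<Sum>y\<in>Y. \<Sum>y'\<in>Y. v y a * v y' a' / (1 + \<alpha>)^2 * (if y = y' then 2 * (1 + \<alpha>) else 0))"
      by (intro sum.cong refl) (simp only: sum_distrib_left[symmetric] vv)
    also have "\<dots> = (\<Sum>y\<in>Y. v y a * v y a' / (1 + \<alpha>)^2 * (2 * (1 + \<alpha>)))"
      using finY by (intro sum.cong refl) (simp add: if_distrib cong: if_cong)
    also have "\<dots> = 2 * G a a'"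
      unfolding G_def sum_distrib_left
    proof (intro sum.cong refl)
      fix y
      have "w / r\<^sup>2 * (2 * r) = 2 * (w / r)" if "r \<noteq> 0" for w r :: real
        using that by (simp add: power2_eq_square)
      from this[of "1 + \<alpha>"] \<alpha>(1)
      show "v y a * v y a' / (1 + \<alpha>)\<^sup>2 * (2 * (1 + \<alpha>)) = 2 * (v y a * v y a' / (1 + \<alpha>))"
        by (metis add_pos_pos less_numeral_extra(1,3))
    qed
    finally show ?thesis .
  qed
  have Gsym: "G a b = G b a" for a b unfolding G_def by (simp add: mult.commute)
  have Rsym: "R a b = R b a" for a b unfolding R_def using Gsym[of a b] by auto
  have RR: "(\<Sum>b\<in>X. R a b * R b a') = of_bool (a = a')" if "a \<in> X" "a' \<in> X" for a a'
  proof -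
    have "(\<Sum>b\<in>X. R a b * R b a') = (\<Sum>b\<in>X. G a b * G b a' - (if b = a' then G a b else 0)
       - (if b = a then G b a' else 0) + (if b = a then of_bool (b = a') else 0))"
      by (rule sum.cong) (auto simp: R_def algebra_simps)
    also have "\<dots> = of_bool (a = a')"
      using that finX by (simp add: sum.distrib sum_subtractf GG)
    finally show ?thesis .
  qed
  define U where "U a b = (if a \<in> X \<and> b \<in> X then complex_of_real (R a (\<sigma> b)) else 0)" for a b
  have "op_mult q N (op_adjoint U) U = op_id q N"
  proof (intro ext)
    fix b b'
    have "op_mult q N (op_adjoint U) U b b' = of_bool (b \<in> X \<and> b' \<in> X) * (\<Sum>a\<in>X. of_real (R (\<sigma> b) a * R a (\<sigma> b')))"
      unfolding op_mult_def op_adjoint_def X_def[symmetric] by (auto simp: U_def Rsym[of "\<sigma> b"])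
    also have "\<dots> = of_bool (b \<in> X \<and> b' \<in> X) * of_real (of_bool (\<sigma> b = \<sigma> b'))"
      using RR[of "\<sigma> b" "\<sigma> b'"] \<sigma> by (auto simp: bij_betwE simp flip: of_real_sum of_real_mult)
    also have "\<dots> = op_id q N b b'"
      using \<sigma> unfolding op_id_def X_def[symmetric] by (auto simp: bij_betw_def inj_on_eq_iff)
    finally show "op_mult q N (op_adjoint U) U b b' = op_id q N b b'" .
  qed
  moreover have "op_mult q N U (op_adjoint U) = op_id q N"
  proof (intro ext)
    fix b b'
    have "op_mult q N U (op_adjoint U) b b' = of_bool (b \<in> X \<and> b' \<in> X) * (\<Sum>a\<in>X. of_real (R b (\<sigma> a) * R (\<sigma> a) b'))"
      unfolding op_mult_def op_adjoint_def X_def[symmetric] by (auto simp: U_def Rsym[of b'])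
    also have "\<dots> = of_bool (b \<in> X \<and> b' \<in> X) * of_real (\<Sum>a\<in>X. R b a * R a b')"
      unfolding sum.reindex_bij_betw[OF \<sigma>, of "\<lambda>a. R b a * R a b'", symmetric] by simp
    also have "\<dots> = op_id q N b b'"
      unfolding op_id_def X_def[symmetric] by (auto simp: RR simp del: of_real_sum)
    finally show "op_mult q N U (op_adjoint U) b b' = op_id q N b b'" .
  qed
  moreover have "U \<in> ops q N" by (auto simp: ops_def U_def X_def)
  moreover have "U x y = (if x \<in> S y then of_real (1 / sqrt (real m)) else 0)" if y: "y \<in> Y" for x y
  proof (cases "x \<in> X")
    case True
    \<comment> \<open>Only the summand for \<open>y\<close> survives, since \<open>t y\<close> lies
      in no other of the sets; its factor \<open>1 + \<alpha>\<close> cancels the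
      denominator.\<close>
    have "G x (t y) = (\<Sum>y'\<in>Y. if y' = y then v y x else 0)"
      unfolding G_def
    proof (rule sum.cong[OF refl])
      fix y' assume y': "y' \<in> Y"
      show "v y' x * v y' (t y) / (1 + \<alpha>) = (if y' = y then v y x else 0)"
      proof (cases "y' = y")
        case True
        then show ?thesis using t[OF y] \<alpha>(1) by (simp add: v_def[of y "t y"] add.commute)
      next
        case False
        then have "t y \<notin> S y'" using t[OF y] disj[OF y y'] by auto
        then show ?thesis using False v0[OF y'] by simp
      qed
    qed
    then have "G x (t y) = v y x" using y finY by simp
    then have "R x (t y) = \<alpha> * of_bool (x \<in> S y)" by (simp add: R_def v_def)
    then show ?thesis using y Y True by (auto simp: U_def \<sigma>_def \<alpha>_def X_def)
  next
    case False
    then show ?thesis using S[OF y] by (auto simp: U_def X_def)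
  qed
  ultimately show ?thesis unfolding op_unitary_def by blast
qed

section \<open>Words and concatenation\<close>

lemma sum_basis_labels_append:
  "(\<Sum>z\<in>basis_labels q (m + n). f z) = (\<Sum>x\<in>basis_labels q m. \<Sum>y\<in>basis_labels q n. f (x @ y))"
  unfolding sum.cartesian_product
  by (rule sum.reindex_bij_witness[of _ "\<lambda>(x, y). x @ y" "\<lambda>z. (take m z, drop m z)"])
    (auto simp: basis_labels_def dest: in_set_takeD in_set_dropD)

lemma basis_labels_append:
  "x \<in> basis_labels q m \<Longrightarrow> y \<in> basis_labels q n \<Longrightarrow> x @ y \<in> basis_labels q (m + n)"
  by (auto simp: basis_labels_def)

lemma length_basis_labels: "x \<in> basis_labels q m \<Longrightarrow> length x = m"
  by (simp add: basis_labels_def)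

lemma replicate_0_basis_labels: "0 < q \<Longrightarrow> replicate m 0 \<in> basis_labels q m"
  by (auto simp: basis_labels_def)

lemma entangled_pairs_append:
  assumes "j \<in> basis_labels q c" "i \<in> basis_labels q c"
  shows "entangled_pairs q c (j @ i) = of_real ((1 / sqrt (real q)) ^ c) * of_bool (j = i)"
proof -
  have "(j @ i = i' @ i') \<longleftrightarrow> (j = i' \<and> i = i')" if "i' \<in> basis_labels q c" for i'
    using that assms by (auto dest!: length_basis_labels)
  then have "entangled_pairs q c (j @ i)
      = (\<Sum>i'\<in>basis_labels q c. if i' = j then of_real ((1 / sqrt (real q)) ^ c) * of_bool (j = i) else 0)"
    unfolding entangled_pairs_def ket_def by (intro sum.cong) auto
  then show ?thesis using assms by simp
qed

section \<open>Codes with flat basis states on disjoint label sets\<close>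

text \<open>\<open>S x i\<close> collects the labels of the transmitted qudits that occur together
  with receiver word \<open>i\<close> when the logical word is \<open>x\<close>. The common size
  \<open>m\<close> lets one amplitude serve all of them, and disjointness makes \<open>x\<close> and
  \<open>i\<close> recoverable from a label.\<close>

locale flat_ea_code =
  fixes q N K c m :: nat and S :: "nat list \<Rightarrow> nat list \<Rightarrow> nat list set"
  assumes q: "1 < q" and Kc: "K + c \<le> N" and m: "0 < m"
    and S_sub: "\<And>x i. x \<in> basis_labels q K \<Longrightarrow> i \<in> basis_labels q c \<Longrightarrow> S x i \<subseteq> basis_labels q N"
    and S_card: "\<And>x i. x \<in> basis_labels q K \<Longrightarrow> i \<in> basis_labels q c \<Longrightarrow> card (S x i) = m"
    and S_disj: "\<And>x i x' i' y. x \<in> basis_labels q K \<Longrightarrow> i \<in> basis_labels q c \<Longrightarrow>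
      x' \<in> basis_labels q K \<Longrightarrow> i' \<in> basis_labels q c \<Longrightarrow> y \<in> S x i \<Longrightarrow> y \<in> S x' i' \<Longrightarrow> x = x' \<and> i = i'"
begin

abbreviation "L \<equiv> basis_labels q"

text \<open>The amplitude \<open>1 / sqrt (m * q ^ c)\<close>, kept as a product: one factor comes
  from the flat columns of the encoder, the other from the entangled pairs.\<close>

definition \<kappa> :: complex where
  "\<kappa> = of_real (1 / sqrt (real m)) * of_real ((1 / sqrt (real q)) ^ c)"

definition codeword :: "nat list \<Rightarrow> qvec" where
  "codeword x = (\<lambda>Y. if drop N Y \<in> L c \<and> take N Y \<in> S x (drop N Y) then \<kappa> else 0)"

text \<open>Codewords have real amplitudes, so the outer products need no conjugation.\<close>

definition proj :: qop where
  "proj = (\<lambda>Y Y'. \<Sum>x\<in>L K. codeword x Y * codeword x Y')"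

lemma cnj_codeword [simp]: "cnj (codeword x Y) = codeword x Y"
  by (simp add: codeword_def \<kappa>_def)

lemma \<kappa>_sq: "\<kappa> * \<kappa> * (of_nat (q ^ c) * of_nat m) = 1"
proof -
  define A B where "A = 1 / sqrt (real m)" and "B = (1 / sqrt (real q)) ^ c"
  have "A * A * real m = 1" using m by (simp add: A_def)
  moreover have "B * B * real q ^ c = 1"
    unfolding B_def power_mult_distrib[symmetric] using q by simp
  ultimately have "(A * A * real m) * (B * B * real q ^ c) = 1" by simp
  then have "A * B * (A * B) * (real (q ^ c) * real m) = 1"
    by (simp only: mult_ac of_nat_power)
  then have "complex_of_real (A * B * (A * B) * (real (q ^ c) * real m)) = 1" by (simp only: of_real_1)
  then show ?thesis unfolding \<kappa>_def A_def[symmetric] B_def[symmetric]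
    by (simp only: of_real_mult of_real_of_nat_eq)
qed

lemma codeword_outside: "x \<in> L K \<Longrightarrow> Y \<notin> L (N + c) \<Longrightarrow> codeword x Y = 0"
  using basis_labels_append[of "take N Y" q N "drop N Y" c] S_sub[of x "drop N Y"]
  by (auto simp: codeword_def)

lemma sum_codeword:
  assumes "x \<in> L K"
  shows "(\<Sum>Y\<in>L (N + c). codeword x Y * f Y) = (\<Sum>i\<in>L c. \<Sum>y\<in>S x i. \<kappa> * f (y @ i))"
proof -
  have "(\<Sum>Y\<in>L (N + c). codeword x Y * f Y) = (\<Sum>y\<in>L N. \<Sum>i\<in>L c. if y \<in> S x i then \<kappa> * f (y @ i) else 0)"
    unfolding sum_basis_labels_append
    by (intro sum.cong refl) (auto simp: codeword_def length_basis_labels)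
  also have "\<dots> = (\<Sum>i\<in>L c. \<Sum>y\<in>L N. if y \<in> S x i then \<kappa> * f (y @ i) else 0)"
    by (rule sum.swap)
  also have "\<dots> = (\<Sum>i\<in>L c. \<Sum>y\<in>S x i. \<kappa> * f (y @ i))"
    using S_sub[OF assms] by (intro sum.cong refl sum.mono_neutral_cong_right) auto
  finally show ?thesis .
qed

lemma codeword_append:
  assumes "x \<in> L K" "i \<in> L c" "y \<in> L N"
  shows "codeword x (y @ i) = (if y \<in> S x i then \<kappa> else 0)"
  using assms by (auto simp: codeword_def length_basis_labels)

lemma codeword_orthonormal:
  assumes "x \<in> L K" "x' \<in> L K"
  shows "(\<Sum>Y\<in>L (N + c). codeword x Y * codeword x' Y) = of_bool (x = x')"
proof -
  have "(\<Sum>Y\<in>L (N + c). codeword x Y * codeword x' Y)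
      = (\<Sum>i\<in>L c. \<Sum>y\<in>S x i. \<kappa> * \<kappa> * of_bool (x = x'))"
    unfolding sum_codeword[OF assms(1)]
  proof (intro sum.cong refl)
    fix i y assume iy: "i \<in> L c" "y \<in> S x i"
    then have "codeword x' (y @ i) = (if y \<in> S x' i then \<kappa> else 0)"
      using S_sub[OF assms(1)] assms(2) by (intro codeword_append) auto
    moreover have "y \<in> S x' i \<longleftrightarrow> x = x'"
      using iy S_disj[OF assms(1) iy(1) assms(2) iy(1) iy(2)] by auto
    ultimately show "\<kappa> * codeword x' (y @ i) = \<kappa> * \<kappa> * of_bool (x = x')" by simp
  qed
  also have "\<dots> = \<kappa> * \<kappa> * (of_nat (q ^ c) * of_nat m) * of_bool (x = x')"
    using S_card[OF assms(1)] by (simp add: card_basis_labels)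
  also have "\<dots> = of_bool (x = x')" by (simp only: \<kappa>_sq mult_1)
  finally show ?thesis .
qed

section \<open>Encoder and projector\<close>

text \<open>The sender's halves of the pairs carry the same word \<open>i\<close> as the receiver's.
  An encoder taking the input label made of \<open>x\<close>, zeros and \<open>i\<close> to the flat
  vector on \<open>S x i\<close> therefore produces \<open>codeword x\<close>.\<close>

lemma exists_encoder:
  "\<exists>U. op_unitary q N U \<and>
    ea_code_space q N K c U = (\<lambda>\<psi> Y. \<Sum>x\<in>L K. \<psi> x * codeword x Y) ` vecs q K"
proof -
  define a where "a = N - K - c"
  have N: "N = K + (a + c)" using Kc by (simp add: a_def)
  define Y0 where "Y0 = (\<lambda>(x, i). x @ replicate a 0 @ i) ` (L K \<times> L c)"
  define S' where "S' y = S (take K y) (drop (K + a) y)" for y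
  have Y0: "y \<in> Y0 \<Longrightarrow> take K y \<in> L K \<and> drop (K + a) y \<in> L c \<and> y = take K y @ replicate a 0 @ drop (K + a) y" for y
    by (auto simp: Y0_def length_basis_labels)
  have "\<exists>U. op_unitary q N U \<and>
      (\<forall>y\<in>Y0. \<forall>x. U x y = (if x \<in> S' y then of_real (1 / sqrt (real m)) else 0))"
  proof (rule unitary_with_flat_columns[OF _ _ _ m])
    show "Y0 \<subseteq> L N"
      unfolding Y0_def N using q by (auto intro!: basis_labels_append replicate_0_basis_labels)
    show "S' y \<subseteq> L N" if "y \<in> Y0" for y using Y0[OF that] S_sub by (auto simp: S'_def)
    show "card (S' y) = m" if "y \<in> Y0" for y using Y0[OF that] S_card by (auto simp: S'_def)
    show "S' y \<inter> S' y' = {}" if "y \<in> Y0" "y' \<in> Y0" "y \<noteq> y'" for y y'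
      using Y0[OF that(1)] Y0[OF that(2)] that(3) S_disj unfolding S'_def by (metis disjoint_iff)
  qed
  then obtain U where U: "op_unitary q N U"
    and U_Y0: "\<And>y x. y \<in> Y0 \<Longrightarrow> U x y = (if x \<in> S' y then of_real (1 / sqrt (real m)) else 0)" by blast
  have Ucol: "U z (x @ replicate a 0 @ i) = (if z \<in> S x i then of_real (1 / sqrt (real m)) else 0)"
    if "x \<in> L K" "i \<in> L c" for x i z
  proof -
    have "x @ replicate a 0 @ i \<in> Y0" using that by (auto simp: Y0_def)
    with U_Y0 show ?thesis using that by (simp add: S'_def length_basis_labels)
  qed
  define r where "r = complex_of_real ((1 / sqrt (real q)) ^ c)"
  have "op_apply q (N + c) (op_tensor N U (op_id q c)) (vec_tensor K \<psi>
      (vec_tensor a (ket (replicate a 0)) (entangled_pairs q c))) = (\<lambda>Y. \<Sum>x\<in>L K. \<psi> x * codeword x Y)"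
    (is "op_apply _ _ ?A ?v = _") for \<psi>
  proof
    fix Y
    have NN: "N + c = K + (a + (c + c))" using N by simp
    \<comment> \<open>The four sums run over logical, ancilla, sender and receiver words. The
      ancilla ket forces \<open>w\<close> to be zero, the pairs force \<open>i = j\<close>, and the
      identity on the receiver forces \<open>j\<close> to be the tail of \<open>Y\<close>.\<close>
    have "op_apply q (N + c) ?A ?v Y
      = (\<Sum>x\<in>L K. \<Sum>w\<in>L a. \<Sum>j\<in>L c. \<Sum>i\<in>L c. U (take N Y) (x @ w @ j) * of_bool (drop N Y = i)
          * (\<psi> x * (of_bool (w = replicate a 0) * (r * of_bool (j = i)))))"
      unfolding op_apply_def NN sum_basis_labels_append
    proof (intro sum.cong refl)
      fix x w j i assume *: "x \<in> L K" "w \<in> L a" "j \<in> L c" "i \<in> L c"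
      have "?A Y (x @ w @ j @ i) = U (take N Y) (x @ w @ j) * of_bool (drop N Y = i)"
        using * by (simp add: op_tensor_def N op_id_def length_basis_labels)
      moreover have "?v (x @ w @ j @ i) = \<psi> x * (of_bool (w = replicate a 0) * (r * of_bool (j = i)))"
        using * by (simp add: vec_tensor_def length_basis_labels ket_def entangled_pairs_append r_def)
      ultimately show "?A Y (x @ w @ j @ i) * ?v (x @ w @ j @ i) = U (take N Y) (x @ w @ j) * of_bool (drop N Y = i)
          * (\<psi> x * (of_bool (w = replicate a 0) * (r * of_bool (j = i))))" by simp
    qed
    also have "\<dots> = (\<Sum>x\<in>L K. \<Sum>w\<in>L a. \<Sum>j\<in>L c. \<Sum>i\<in>L c. if i = j then U (take N Y) (x @ w @ j) * of_bool (drop N Y = j)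
          * (\<psi> x * (of_bool (w = replicate a 0) * r)) else 0)"
      by (intro sum.cong refl) auto
    also have "\<dots> = (\<Sum>x\<in>L K. \<Sum>w\<in>L a. if w = replicate a 0 then \<Sum>j\<in>L c. U (take N Y) (x @ w @ j) * of_bool (drop N Y = j)
          * (\<psi> x * r) else 0)"
      by (intro sum.cong refl) simp
    also have "\<dots> = (\<Sum>x\<in>L K. \<Sum>j\<in>L c. U (take N Y) (x @ replicate a 0 @ j) * of_bool (drop N Y = j) * (\<psi> x * r))"
      using q by (simp add: replicate_0_basis_labels)
    also have "\<dots> = (\<Sum>x\<in>L K. \<Sum>j\<in>L c. if drop N Y = j then U (take N Y) (x @ replicate a 0 @ drop N Y) * (\<psi> x * r) else 0)"
      by (intro sum.cong refl) auto
    also have "\<dots> = (\<Sum>x\<in>L K. \<psi> x * codeword x Y)"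
      by (intro sum.cong refl) (auto simp: codeword_def Ucol \<kappa>_def r_def)
    finally show "op_apply q (N + c) ?A ?v Y = (\<Sum>x\<in>L K. \<psi> x * codeword x Y)" .
  qed
  then have "ea_code_space q N K c U = (\<lambda>\<psi> Y. \<Sum>x\<in>L K. \<psi> x * codeword x Y) ` vecs q K"
    unfolding ea_code_space_def a_def by simp
  then show ?thesis using U by blast
qed

lemma op_apply_proj:
  "op_apply q (N + c) proj v = (\<lambda>Y. \<Sum>x\<in>L K. (\<Sum>Y'\<in>L (N + c). codeword x Y' * v Y') * codeword x Y)"
  unfolding op_apply_def proj_def sum_distrib_right
  by (subst sum.swap) (simp add: mult_ac)

lemma projector_onto_proj:
  "projector_onto q (N + c) proj ((\<lambda>\<psi> Y. \<Sum>x\<in>L K. \<psi> x * codeword x Y) ` vecs q K)"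
  unfolding projector_onto_def
proof (intro conjI)
  show "proj \<in> ops q (N + c)" by (auto simp: ops_def proj_def codeword_outside)
  show "op_adjoint proj = proj" by (simp add: op_adjoint_def proj_def mult.commute)
  have fixed: "op_apply q (N + c) proj (\<lambda>Y. \<Sum>x\<in>L K. \<psi> x * codeword x Y) = (\<lambda>Y. \<Sum>x\<in>L K. \<psi> x * codeword x Y)"
    for \<psi>
  proof -
    have "(\<Sum>Y'\<in>L (N + c). codeword x Y' * (\<Sum>x'\<in>L K. \<psi> x' * codeword x' Y')) = \<psi> x" if "x \<in> L K" for x
    proof -
      have "(\<Sum>Y'\<in>L (N + c). codeword x Y' * (\<Sum>x'\<in>L K. \<psi> x' * codeword x' Y'))
          = (\<Sum>x'\<in>L K. \<psi> x' * (\<Sum>Y'\<in>L (N + c). codeword x Y' * codeword x' Y'))"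
        unfolding sum_distrib_left by (subst sum.swap) (simp add: mult_ac)
      also have "\<dots> = (\<Sum>x'\<in>L K. if x' = x then \<psi> x else 0)"
        using that by (intro sum.cong refl) (auto simp: codeword_orthonormal)
      finally show ?thesis using that by simp
    qed
    then show ?thesis unfolding op_apply_proj by simp
  qed
  \<comment> \<open>The columns of \<open>proj\<close> are themselves combinations of codewords, so
    idempotence is an instance of \<open>fixed\<close>.\<close>
  show "op_mult q (N + c) proj proj = proj"
  proof (intro ext)
    fix Y Y'
    have "op_mult q (N + c) proj proj Y Y' = op_apply q (N + c) proj (\<lambda>Z. \<Sum>x\<in>L K. codeword x Y' * codeword x Z) Y"
      by (simp add: op_mult_def op_apply_def proj_def mult.commute)
    also have "\<dots> = proj Y Y'" unfolding fixed by (simp add: proj_def mult.commute)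
    finally show "op_mult q (N + c) proj proj Y Y' = proj Y Y'" .
  qed
  show "op_apply q (N + c) proj ` vecs q (N + c) = (\<lambda>\<psi> Y. \<Sum>x\<in>L K. \<psi> x * codeword x Y) ` vecs q K"
  proof (intro equalityI subsetI)
    fix w assume "w \<in> op_apply q (N + c) proj ` vecs q (N + c)"
    then obtain v where "w = op_apply q (N + c) proj v" by blast
    \<comment> \<open>The coefficients are cut off outside \<open>L K\<close> so that they form an
      element of \<open>vecs q K\<close>.\<close>
    then have "w = (\<lambda>Y. \<Sum>x\<in>L K. (\<lambda>x. if x \<in> L K then \<Sum>Y'\<in>L (N + c). codeword x Y' * v Y' else 0) x * codeword x Y)"
      unfolding op_apply_proj by (auto intro!: sum.cong)
    then show "w \<in> (\<lambda>\<psi> Y. \<Sum>x\<in>L K. \<psi> x * codeword x Y) ` vecs q K"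
      by (intro image_eqI[where x = "\<lambda>x. if x \<in> L K then \<Sum>Y'\<in>L (N + c). codeword x Y' * v Y' else 0"])
        (auto simp: vecs_def)
  next
    fix w assume "w \<in> (\<lambda>\<psi> Y. \<Sum>x\<in>L K. \<psi> x * codeword x Y) ` vecs q K"
    then obtain \<psi> where w: "w = (\<lambda>Y. \<Sum>x\<in>L K. \<psi> x * codeword x Y)" by blast
    then have "w \<in> vecs q (N + c)" by (auto simp: vecs_def codeword_outside)
    then show "w \<in> op_apply q (N + c) proj ` vecs q (N + c)"
      using fixed[of \<psi>] w by (metis image_eqI)
  qed
qed

text \<open>As the receiver's qudits are untouched, the codewords on the two sides of the error meet
  only at equal receiver words; hence a single sum over \<open>i\<close>.\<close>

lemma sandwich:
  "op_mult q (N + c) proj (op_mult q (N + c) (op_tensor N E (op_id q c)) proj) Y Y' =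
   (\<Sum>x\<in>L K. \<Sum>x'\<in>L K. codeword x Y * codeword x' Y' *
     (\<Sum>i\<in>L c. \<Sum>y\<in>S x i. \<Sum>y'\<in>S x' i. \<kappa> * \<kappa> * E y y'))"
proof -
  let ?A = "op_tensor N E (op_id q c)"
  have A: "(\<Sum>Z\<in>L (N + c). codeword x Z * (\<Sum>Z'\<in>L (N + c). codeword x' Z' * ?A Z Z'))
      = (\<Sum>i\<in>L c. \<Sum>y\<in>S x i. \<Sum>y'\<in>S x' i. \<kappa> * \<kappa> * E y y')" if x: "x \<in> L K" "x' \<in> L K" for x x'
    unfolding sum_codeword[OF x(1)] sum_codeword[OF x(2)]
  proof (intro sum.cong refl)
    fix i y assume i: "i \<in> L c" "y \<in> S x i"
    have "(\<Sum>y'\<in>S x' i'. \<kappa> * ?A (y @ i) (y' @ i')) = (if i' = i then \<Sum>y'\<in>S x' i. \<kappa> * E y y' else 0)"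
      if i': "i' \<in> L c" for i'
    proof -
      have "?A (y @ i) (y' @ i') = (if i' = i then E y y' else 0)" if "y' \<in> S x' i'" for y'
      proof -
        have "y \<in> L N" "y' \<in> L N" using S_sub[OF x(1) i(1)] S_sub[OF x(2) i'] i that by auto
        then show ?thesis using i' by (auto simp: op_tensor_def op_id_def length_basis_labels)
      qed
      then show ?thesis by (auto intro!: sum.cong)
    qed
    then have "(\<Sum>i'\<in>L c. \<Sum>y'\<in>S x' i'. \<kappa> * ?A (y @ i) (y' @ i')) = (\<Sum>y'\<in>S x' i. \<kappa> * E y y')"
      using i by simp
    then show "\<kappa> * (\<Sum>i'\<in>L c. \<Sum>y'\<in>S x' i'. \<kappa> * ?A (y @ i) (y' @ i')) = (\<Sum>y'\<in>S x' i. \<kappa> * \<kappa> * E y y')"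
      by (simp add: sum_distrib_left mult_ac)
  qed
  have "op_mult q (N + c) proj (op_mult q (N + c) ?A proj) Y Y'
      = (\<Sum>Z\<in>L (N + c). \<Sum>Z'\<in>L (N + c). \<Sum>x\<in>L K. \<Sum>x'\<in>L K.
          codeword x Y * codeword x' Y' * (codeword x Z * (codeword x' Z' * ?A Z Z')))"
    unfolding op_mult_def
  proof (rule sum.cong[OF refl])
    fix Z
    have "proj Y Z * (\<Sum>Z'\<in>L (N + c). ?A Z Z' * proj Z' Y') = (\<Sum>Z'\<in>L (N + c). ?A Z Z' * (proj Y Z * proj Z' Y'))"
      by (simp only: sum_distrib_left mult_ac)
    also have "\<dots> = (\<Sum>Z'\<in>L (N + c). \<Sum>x\<in>L K. \<Sum>x'\<in>L K.
        ?A Z Z' * ((codeword x Y * codeword x Z) * (codeword x' Z' * codeword x' Y')))"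
      unfolding proj_def sum_product by (simp only: sum_distrib_left)
    finally show "proj Y Z * (\<Sum>Z'\<in>L (N + c). ?A Z Z' * proj Z' Y') = (\<Sum>Z'\<in>L (N + c). \<Sum>x\<in>L K. \<Sum>x'\<in>L K.
          codeword x Y * codeword x' Y' * (codeword x Z * (codeword x' Z' * ?A Z Z')))"
      by (simp only: mult_ac)
  qed
  also have "\<dots> = (\<Sum>Z\<in>L (N + c). \<Sum>x\<in>L K. \<Sum>Z'\<in>L (N + c). \<Sum>x'\<in>L K.
          codeword x Y * codeword x' Y' * (codeword x Z * (codeword x' Z' * ?A Z Z')))"
    by (rule sum.cong[OF refl], rule sum.swap)
  also have "\<dots> = (\<Sum>Z\<in>L (N + c). \<Sum>x\<in>L K. \<Sum>x'\<in>L K. \<Sum>Z'\<in>L (N + c).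
          codeword x Y * codeword x' Y' * (codeword x Z * (codeword x' Z' * ?A Z Z')))"
    by (rule sum.cong[OF refl], rule sum.cong[OF refl], rule sum.swap)
  also have "\<dots> = (\<Sum>x\<in>L K. \<Sum>Z\<in>L (N + c). \<Sum>x'\<in>L K. \<Sum>Z'\<in>L (N + c).
          codeword x Y * codeword x' Y' * (codeword x Z * (codeword x' Z' * ?A Z Z')))"
    by (rule sum.swap)
  also have "\<dots> = (\<Sum>x\<in>L K. \<Sum>x'\<in>L K. \<Sum>Z\<in>L (N + c). \<Sum>Z'\<in>L (N + c).
          codeword x Y * codeword x' Y' * (codeword x Z * (codeword x' Z' * ?A Z Z')))"
    by (rule sum.cong[OF refl], rule sum.swap)
  also have "\<dots> = (\<Sum>x\<in>L K. \<Sum>x'\<in>L K. codeword x Y * codeword x' Y' *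
     (\<Sum>i\<in>L c. \<Sum>y\<in>S x i. \<Sum>y'\<in>S x' i. \<kappa> * \<kappa> * E y y'))"
  proof (intro sum.cong refl)
    fix x x' assume "x \<in> L K" "x' \<in> L K"
    then show "(\<Sum>Z\<in>L (N + c). \<Sum>Z'\<in>L (N + c). codeword x Y * codeword x' Y' * (codeword x Z * (codeword x' Z' * ?A Z Z')))
      = codeword x Y * codeword x' Y' * (\<Sum>i\<in>L c. \<Sum>y\<in>S x i. \<Sum>y'\<in>S x' i. \<kappa> * \<kappa> * E y y')"
      by (simp only: A[symmetric] sum_distrib_left)
  qed
  finally show ?thesis .
qed

section \<open>Minimum distance\<close>

text \<open>This is the Knill-Laflamme criterion. A nonzero entry \<open>E y y'\<close> needs labels
  that differ inside \<open>T\<close> only, so \<open>pure\<close> leaves just the diagonal entries,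
  and \<open>unif\<close> makes their total independent of the logical word.\<close>

lemma min_dist_at_least_proj:
  assumes pure: "\<And>x x' i y y'. x \<in> L K \<Longrightarrow> x' \<in> L K \<Longrightarrow> i \<in> L c \<Longrightarrow> y \<in> S x i \<Longrightarrow> y' \<in> S x' i \<Longrightarrow>
      card {j. j < N \<and> y ! j \<noteq> y' ! j} < d \<Longrightarrow> y = y'"
    and unif: "\<And>T x x' (g :: nat list \<Rightarrow> complex). T \<subseteq> {..<N} \<Longrightarrow> card T < d \<Longrightarrow> x \<in> L K \<Longrightarrow> x' \<in> L K \<Longrightarrow>
      (\<Sum>i\<in>L c. \<Sum>y\<in>S x i. g (nths y T)) = (\<Sum>i\<in>L c. \<Sum>y\<in>S x' i. g (nths y T))"
  shows "min_dist_at_least q N c proj d"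
  unfolding min_dist_at_least_def
proof (intro allI impI, elim conjE)
  fix T E assume T: "T \<subseteq> {..<N}" "card T < d" and "acts_only_on q N T E"
  then obtain M where M: "\<And>y y'. y \<in> L N \<Longrightarrow> y' \<in> L N \<Longrightarrow>
      E y y' = (if \<forall>i\<in>{..<N} - T. y ! i = y' ! i then M (nths y T) (nths y' T) else 0)"
    unfolding acts_only_on_def by blast
  define x0 where "x0 = replicate K (0::nat)"
  have x0: "x0 \<in> L K" using q by (simp add: x0_def replicate_0_basis_labels)
  define z where "z = \<kappa> * \<kappa> * (\<Sum>i\<in>L c. \<Sum>y\<in>S x0 i. M (nths y T) (nths y T))"
  have B: "(\<Sum>i\<in>L c. \<Sum>y\<in>S x i. \<Sum>y'\<in>S x' i. \<kappa> * \<kappa> * E y y') = of_bool (x = x') * z"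
    if x: "x \<in> L K" "x' \<in> L K" for x x'
  proof -
    have "(\<Sum>i\<in>L c. \<Sum>y\<in>S x i. \<Sum>y'\<in>S x' i. \<kappa> * \<kappa> * E y y')
       = (\<Sum>i\<in>L c. \<Sum>y\<in>S x i. of_bool (x = x') * (\<kappa> * \<kappa> * M (nths y T) (nths y T)))"
    proof (intro sum.cong refl)
      fix i y assume i: "i \<in> L c" "y \<in> S x i"
      have E: "E y y' = (if y' = y then of_bool (x = x') * M (nths y T) (nths y T) else 0)"
        if y': "y' \<in> S x' i" for y'
      proof (cases "\<forall>j\<in>{..<N} - T. y ! j = y' ! j")
        case True
        then have "card {j. j < N \<and> y ! j \<noteq> y' ! j} \<le> card T"
          using T finite_subset[OF T(1)] by (intro card_mono) auto
        then have "y = y'" using pure[OF x i y'] T(2) by linarith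
        moreover from this have "x = x'" using S_disj[OF x(1) i(1) x(2) i(1) i(2)] y' by simp
        ultimately show ?thesis using M[of y y'] S_sub[OF x(1) i(1)] i(2) by auto
      next
        case False
        then have "y' \<noteq> y" by auto
        then show ?thesis using M[of y y'] False S_sub[OF x(1) i(1)] S_sub[OF x(2) i(1)] i(2) y' by auto
      qed
      have "finite (S x' i)" using S_sub[OF x(2) i(1)] finite_subset finite_basis_labels by blast
      moreover have "y \<in> S x' i \<longleftrightarrow> x = x'"
        using S_disj[OF x(1) i(1) x(2) i(1) i(2)] i(2) by auto
      ultimately show "(\<Sum>y'\<in>S x' i. \<kappa> * \<kappa> * E y y') = of_bool (x = x') * (\<kappa> * \<kappa> * M (nths y T) (nths y T))"
        by (simp add: E if_distrib cong: if_cong)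
    qed
    also have "\<dots> = of_bool (x = x') * (\<kappa> * \<kappa> * (\<Sum>i\<in>L c. \<Sum>y\<in>S x i. M (nths y T) (nths y T)))"
      by (simp add: sum_distrib_left)
    also have "\<dots> = of_bool (x = x') * z"
      unfolding z_def using unif[OF T x(1) x0, of "\<lambda>w. M w w"] by simp
    finally show ?thesis .
  qed
  have "op_mult q (N + c) proj (op_mult q (N + c) (op_tensor N E (op_id q c)) proj) Y Y' = z * proj Y Y'" for Y Y'
  proof -
    have "(\<Sum>x\<in>L K. \<Sum>x'\<in>L K. codeword x Y * codeword x' Y' *
        (\<Sum>i\<in>L c. \<Sum>y\<in>S x i. \<Sum>y'\<in>S x' i. \<kappa> * \<kappa> * E y y'))
      = (\<Sum>x\<in>L K. \<Sum>x'\<in>L K. if x' = x then z * (codeword x Y * codeword x Y') else 0)"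
      by (intro sum.cong refl) (auto simp: B)
    then show ?thesis unfolding sandwich by (simp add: proj_def sum_distrib_left)
  qed
  then show "detects q N c proj E" unfolding detects_def by blast
qed

text \<open>With \<open>0 < K\<close> there are two logical words. Projecting the transmitted qudits
  onto the labels that occur in the codeword of \<open>x0\<close> turns the sandwich into the
  rank-one projector onto that codeword, which is no multiple of \<open>proj\<close>. This bounds
  all distances by \<open>N\<close>.\<close>

lemma not_min_dist_at_least_proj:
  assumes "0 < K"
  shows "\<not> min_dist_at_least q N c proj (Suc N)"
proof
  assume *: "min_dist_at_least q N c proj (Suc N)"
  define x0 x1 where "x0 = replicate K (0::nat)" and "x1 = replicate K (1::nat)"
  have x: "x0 \<in> L K" "x1 \<in> L K" "x0 \<noteq> x1"
    using q assms by (auto simp: x0_def x1_def basis_labels_def)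
  define A where "A = (\<Union>i\<in>L c. S x0 i)"
  have A: "A \<subseteq> L N" using S_sub[OF x(1)] by (auto simp: A_def)
  define E where "E y y' = (if y = y' \<and> y \<in> A then 1 else 0 :: complex)" for y y'
  have "acts_only_on q N {..<N} E"
    unfolding acts_only_on_def
    using A by (auto simp: ops_def E_def basis_labels_def nths_upt_eq_take intro!: exI[of _ E])
  then have "detects q N c proj E"
    using *[unfolded min_dist_at_least_def, rule_format, of "{..<N}" E] by simp
  then obtain z where z: "\<And>Y Y'. op_mult q (N + c) proj (op_mult q (N + c) (op_tensor N E (op_id q c)) proj) Y Y' = z * proj Y Y'"
    unfolding detects_def by metis
  have B: "(\<Sum>i\<in>L c. \<Sum>y\<in>S x i. \<Sum>y'\<in>S x' i. \<kappa> * \<kappa> * E y y') = of_bool (x = x0 \<and> x' = x0)"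
    if xx: "x \<in> L K" "x' \<in> L K" for x x'
  proof -
    have "(\<Sum>i\<in>L c. \<Sum>y\<in>S x i. \<Sum>y'\<in>S x' i. \<kappa> * \<kappa> * E y y')
        = (\<Sum>i\<in>L c. \<Sum>y\<in>S x i. \<kappa> * \<kappa> * of_bool (x = x0 \<and> x' = x0))"
    proof (intro sum.cong refl)
      fix i y assume i: "i \<in> L c" "y \<in> S x i"
      have "finite (S x' i)" using S_sub[OF xx(2) i(1)] finite_subset finite_basis_labels by blast
      moreover have "y \<in> S x' i \<longleftrightarrow> x = x'"
        using S_disj[OF xx(1) i(1) xx(2) i(1) i(2)] i(2) by auto
      moreover have "y \<in> A \<longleftrightarrow> x = x0"
        using S_disj[OF xx(1) i(1) x(1) _ i(2)] i by (auto simp: A_def)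
      ultimately show "(\<Sum>y'\<in>S x' i. \<kappa> * \<kappa> * E y y') = \<kappa> * \<kappa> * of_bool (x = x0 \<and> x' = x0)"
        by (auto simp: E_def if_distrib cong: if_cong)
    qed
    also have "\<dots> = \<kappa> * \<kappa> * (of_nat (q ^ c) * of_nat m) * of_bool (x = x0 \<and> x' = x0)"
      using S_card[OF xx(1)] by (simp add: card_basis_labels)
    also have "\<dots> = of_bool (x = x0 \<and> x' = x0)" by (simp only: \<kappa>_sq mult_1)
    finally show ?thesis .
  qed
  have rank1: "codeword x0 Y * codeword x0 Y' = z * proj Y Y'" for Y Y'
  proof -
    have "(\<Sum>x\<in>L K. \<Sum>x'\<in>L K. codeword x Y * codeword x' Y' * of_bool (x = x0 \<and> x' = x0))
       = (\<Sum>x\<in>L K. if x = x0 then \<Sum>x'\<in>L K. if x' = x0 then codeword x Y * codeword x' Y' else 0 else 0)"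
      by (intro sum.cong refl) (auto intro!: sum.cong)
    also have "\<dots> = codeword x0 Y * codeword x0 Y'" using x(1) by simp
    finally show ?thesis using z[of Y Y'] unfolding sandwich by (simp add: B)
  qed
  \<comment> \<open>A label in the support of \<open>codeword x\<close> lies in no other support.
    Comparing at such labels for \<open>x0\<close> and \<open>x1\<close> gives \<open>z = 1\<close>
    and \<open>z = 0\<close>.\<close>
  have diag: "\<exists>Y. (\<forall>x'\<in>L K. codeword x' Y = (if x' = x then \<kappa> else 0)) \<and> proj Y Y = \<kappa> * \<kappa>"
    if xK: "x \<in> L K" for x
  proof -
    define i where "i = replicate c (0::nat)"
    have i: "i \<in> L c" using q by (simp add: i_def replicate_0_basis_labels)
    obtain y where y: "y \<in> S x i" using S_card[OF xK i] m by (metis card.empty less_not_refl ex_in_conv)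
    then have yN: "y \<in> L N" using S_sub[OF xK i] by blast
    have 1: "codeword x' (y @ i) = (if x' = x then \<kappa> else 0)" if "x' \<in> L K" for x'
    proof -
      have "y \<in> S x' i \<longleftrightarrow> x' = x" using S_disj[OF xK i that i y] y by blast
      then show ?thesis using codeword_append[OF that i yN] by simp
    qed
    have "proj (y @ i) (y @ i) = (\<Sum>x'\<in>L K. if x' = x then \<kappa> * \<kappa> else 0)"
      unfolding proj_def by (intro sum.cong refl) (simp add: 1)
    then have "proj (y @ i) (y @ i) = \<kappa> * \<kappa>" using xK by simp
    with 1 show ?thesis by blast
  qed
  have \<kappa>0: "\<kappa> \<noteq> 0" using \<kappa>_sq by auto
  obtain Y0 where Y0: "\<forall>x'\<in>L K. codeword x' Y0 = (if x' = x0 then \<kappa> else 0)" "proj Y0 Y0 = \<kappa> * \<kappa>"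
    using diag[OF x(1)] by blast
  then have "\<kappa> * \<kappa> = z * (\<kappa> * \<kappa>)" using rank1[of Y0 Y0] x(1) by simp
  then have "z = 1" using \<kappa>0 by simp
  obtain Y1 where Y1: "\<forall>x'\<in>L K. codeword x' Y1 = (if x' = x1 then \<kappa> else 0)" "proj Y1 Y1 = \<kappa> * \<kappa>"
    using diag[OF x(2)] by blast
  then have "codeword x0 Y1 = 0" using x by simp
  then have "z * (\<kappa> * \<kappa>) = 0" using rank1[of Y1 Y1] Y1(2) by simp
  then show False using \<open>z = 1\<close> \<kappa>0 by simp
qed

text \<open>\<open>EAQECC_exists\<close> asks for the exact distance, so the greatest admissible
  value is taken; it exists because no distance exceeds \<open>N\<close>.\<close>

theorem EAQECC_existsI:
  assumes "0 < K"
    and pure: "\<And>x x' i y y'. x \<in> L K \<Longrightarrow> x' \<in> L K \<Longrightarrow> i \<in> L c \<Longrightarrow> y \<in> S x i \<Longrightarrow> y' \<in> S x' i \<Longrightarrow>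
      card {j. j < N \<and> y ! j \<noteq> y' ! j} < d \<Longrightarrow> y = y'"
    and unif: "\<And>T x x' (g :: nat list \<Rightarrow> complex). T \<subseteq> {..<N} \<Longrightarrow> card T < d \<Longrightarrow> x \<in> L K \<Longrightarrow> x' \<in> L K \<Longrightarrow>
      (\<Sum>i\<in>L c. \<Sum>y\<in>S x i. g (nths y T)) = (\<Sum>i\<in>L c. \<Sum>y\<in>S x' i. g (nths y T))"
  shows "\<exists>d'\<ge>d. EAQECC_exists q N K d' c"
proof -
  let ?P = "min_dist_at_least q N c proj"
  have mono: "?P e" if "?P e'" "e \<le> e'" for e e'
    using that unfolding min_dist_at_least_def by (meson less_le_trans)
  have d: "?P d" by (rule min_dist_at_least_proj[OF pure unif])
  have bound: "e \<le> N" if "?P e" for e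
    using mono[OF that] not_min_dist_at_least_proj[OF assms(1)] by (meson not_less_eq_eq)
  define d' where "d' = (GREATEST e. ?P e)"
  have "?P d'" unfolding d'_def using d bound by (rule GreatestI_nat)
  moreover have "d \<le> d'" unfolding d'_def using d bound by (rule Greatest_le_nat)
  moreover have "\<not> ?P (Suc d')"
    using Greatest_le_nat[of ?P "Suc d'" N] bound unfolding d'_def by fastforce
  ultimately show ?thesis
    unfolding EAQECC_exists_def using exists_encoder projector_onto_proj Kc by metis
qed

end

section \<open>Codes from pairs of additive subgroups\<close>

definition is_add_subgroup :: "'b::ab_group_add set \<Rightarrow> bool" where
  "is_add_subgroup G \<longleftrightarrow> 0 \<in> G \<and> (\<forall>x\<in>G. \<forall>y\<in>G. x - y \<in> G)"

lemma is_add_subgroup_diff: "is_add_subgroup G \<Longrightarrow> x \<in> G \<Longrightarrow> y \<in> G \<Longrightarrow> x - y \<in> G"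
  by (simp add: is_add_subgroup_def)

lemma is_add_subgroup_uminus: "is_add_subgroup G \<Longrightarrow> x \<in> G \<Longrightarrow> - x \<in> G"
  unfolding is_add_subgroup_def by (metis diff_0)

lemma is_add_subgroup_add: "is_add_subgroup G \<Longrightarrow> x \<in> G \<Longrightarrow> y \<in> G \<Longrightarrow> x + y \<in> G"
  using is_add_subgroup_uminus[of G y] unfolding is_add_subgroup_def by (metis diff_minus_eq_add)

lemma is_add_subgroup_Int: "is_add_subgroup G \<Longrightarrow> is_add_subgroup H \<Longrightarrow> is_add_subgroup (G \<inter> H)"
  by (auto simp: is_add_subgroup_def)

text \<open>\<open>A\<close> will be a set of words with as many elements as there are cosets of
  \<open>W\<close>, so that words index cosets; \<open>r\<close> picks the representatives.\<close>

lemma coset_transversal: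
  fixes G W :: "'b::ab_group_add set"
  assumes "finite G" and G: "is_add_subgroup G" and W: "is_add_subgroup W" "W \<subseteq> G"
    and A: "finite A" "card G = card A * card W"
  shows "\<exists>r. (\<forall>a\<in>A. r a \<in> G) \<and> (\<forall>a\<in>A. \<forall>b\<in>A. r a - r b \<in> W \<longrightarrow> a = b) \<and>
    (\<forall>g\<in>G. \<exists>a\<in>A. g - r a \<in> W)"
proof -
  define cos where "cos g = (+) g ` W" for g
  have mem: "h \<in> cos g \<longleftrightarrow> h - g \<in> W" for g h
    by (auto simp: cos_def image_iff) (metis add_diff_cancel_left' diff_add_cancel add.commute)+
  have eq: "cos g = cos h" if "g - h \<in> W" for g h
  proof -
    have "x - g \<in> W \<longleftrightarrow> x - h \<in> W" for x
      using is_add_subgroup_add[OF W(1) _ that, of "x - g"] W(1) that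
      unfolding is_add_subgroup_def by (metis add_diff_cancel_right' diff_add_cancel diff_diff_eq2 add_diff_eq)
    then show ?thesis using mem by blast
  qed
  have self: "g \<in> cos g" for g using W(1) by (simp add: mem is_add_subgroup_def)
  have U: "\<Union> (cos ` G) = G"
  proof
    show "\<Union> (cos ` G) \<subseteq> G" unfolding cos_def using is_add_subgroup_add[OF G] W(2) by auto
    show "G \<subseteq> \<Union> (cos ` G)" using self by blast
  qed
  \<comment> \<open>The cosets partition \<open>G\<close> into blocks of size \<open>card W\<close>;
    hence there are \<open>card A\<close> of them.\<close>
  have "card W * card (cos ` G) = card (\<Union> (cos ` G))"
  proof (rule card_partition)
    show "finite (cos ` G)" "finite (\<Union> (cos ` G))" using assms(1) U by auto
    show "card c = card W" if "c \<in> cos ` G" for c using that by (auto simp: cos_def card_image)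
    show "c \<inter> c' = {}" if cc: "c \<in> cos ` G" "c' \<in> cos ` G" "c \<noteq> c'" for c c'
    proof (rule ccontr)
      assume "c \<inter> c' \<noteq> {}"
      then obtain x g h where "x - g \<in> W" "x - h \<in> W" "c = cos g" "c' = cos h"
        using cc mem by blast
      then show False using eq cc(3) by metis
    qed
  qed
  moreover have "card W > 0" using W assms(1) by (metis card_gt_0_iff empty_iff finite_subset is_add_subgroup_def)
  ultimately have "card A = card (cos ` G)" using A(2) U by (metis mult.commute mult_cancel1 less_not_refl)
  then obtain f where f: "bij_betw f A (cos ` G)" using A(1) assms(1) by (meson finite_imageI finite_same_card_bij)
  then have "\<forall>a\<in>A. \<exists>g\<in>G. f a = cos g" by (blast dest: bij_betwE)
  then obtain r where r: "\<And>a. a \<in> A \<Longrightarrow> r a \<in> G" "\<And>a. a \<in> A \<Longrightarrow> f a = cos (r a)" by metis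
  show ?thesis
  proof (intro exI[of _ r] conjI ballI impI)
    show "r a \<in> G" if "a \<in> A" for a using r(1) that .
    show "a = b" if "a \<in> A" "b \<in> A" "r a - r b \<in> W" for a b
      using eq[OF that(3)] r(2) that f by (metis bij_betw_inv_into_left)
    show "\<exists>a\<in>A. g - r a \<in> W" if "g \<in> G" for g
    proof -
      have "cos g \<in> f ` A" using f that by (auto simp: bij_betw_def)
      then obtain a where "a \<in> A" "cos g = cos (r a)" using r(2) by auto
      then show ?thesis using self[of g] mem by blast
    qed
  qed
qed

section \<open>Vectors over a finite field as digit words\<close>

definition supp_vecs :: "nat \<Rightarrow> (nat \<Rightarrow> 'a::zero) set" where
  "supp_vecs N = {v. \<forall>i\<ge>N. v i = 0}"

text \<open>Field elements become digits through an arbitrary bijection, since the later arguments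
  only compare digits for equality.\<close>

lemma bij_betw_map_supp_vecs:
  assumes "bij_betw \<phi> (UNIV :: 'a::zero set) {..<q}"
  shows "bij_betw (\<lambda>v. map (\<lambda>i. \<phi> (v i)) [0..<N]) (supp_vecs N) (basis_labels q N)"
proof (rule bij_betw_byWitness[where f' = "\<lambda>y i. if i < N then inv \<phi> (y ! i) else 0"])
  have inv: "inv \<phi> (\<phi> x) = x" for x using assms by (simp add: bij_betw_def)
  have inv': "j < q \<Longrightarrow> \<phi> (inv \<phi> j) = j" for j using assms by (simp add: bij_betw_def f_inv_into_f)
  show "\<forall>v\<in>supp_vecs N. (\<lambda>i. if i < N then inv \<phi> (map (\<lambda>i. \<phi> (v i)) [0..<N] ! i) else 0) = v"
    by (auto simp: supp_vecs_def inv)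
  show "\<forall>y\<in>basis_labels q N. map (\<lambda>i. \<phi> (if i < N then inv \<phi> (y ! i) else 0)) [0..<N] = y"
    by (auto simp: basis_labels_def subset_iff inv' intro!: nth_equalityI)
  show "(\<lambda>v. map (\<lambda>i. \<phi> (v i)) [0..<N]) ` supp_vecs N \<subseteq> basis_labels q N"
    using bij_betwE[OF assms] by (auto simp: basis_labels_def)
  show "(\<lambda>y i. if i < N then inv \<phi> (y ! i) else 0) ` basis_labels q N \<subseteq> supp_vecs N"
    by (auto simp: supp_vecs_def)
qed

lemma finite_supp_vecs [simp]: "finite (supp_vecs N :: (nat \<Rightarrow> 'a::{zero,finite}) set)"
  and card_supp_vecs: "card (supp_vecs N :: (nat \<Rightarrow> 'a::{zero,finite}) set) = CARD('a) ^ N"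
proof -
  obtain \<phi> where "bij_betw \<phi> (UNIV :: 'a set) {..<CARD('a)}"
    using ex_bij_betw_finite_nat[of "UNIV :: 'a set"] by (auto simp: atLeast0LessThan)
  from bij_betw_map_supp_vecs[OF this, of N]
  show "finite (supp_vecs N :: (nat \<Rightarrow> 'a) set)" "card (supp_vecs N :: (nat \<Rightarrow> 'a) set) = CARD('a) ^ N"
    by (auto dest: bij_betw_finite bij_betw_same_card simp: card_basis_labels)
qed

lemma is_add_subgroup_supp_vecs: "is_add_subgroup (supp_vecs N :: (nat \<Rightarrow> 'a::ab_group_add) set)"
  by (auto simp: is_add_subgroup_def supp_vecs_def)

section \<open>From a pair of codes to a quantum code\<close>

text \<open>The exponents count cosets of \<open>C \<inter> D\<close>: with
  \<open>q = CARD('a)\<close>, there are \<open>q ^ K\<close> of them in \<open>C\<close>, one for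
  each logical word, and \<open>q ^ (N + K - 2 * k)\<close> in \<open>D\<close>, one for each
  receiver word. \<open>dist\<close> delivers purity of the flat code, \<open>proj\<close> its
  uniformity.\<close>

theorem EAQECC_from_code_pair:
  fixes C D :: "(nat \<Rightarrow> 'a::{field,finite}) set"
  assumes C: "is_add_subgroup C" "C \<subseteq> supp_vecs N" "card C = CARD('a) ^ k"
    and D: "is_add_subgroup D" "D \<subseteq> supp_vecs N" "card D = CARD('a) ^ (N - k)"
    and CD: "card (C \<inter> D) = CARD('a) ^ (k - K)"
    and K: "0 < K" "K \<le> k" "k \<le> N" "2 * k \<le> N + K"
    and dist: "\<And>v. v \<in> C \<Longrightarrow> v \<noteq> 0 \<Longrightarrow> d \<le> card {j. j < N \<and> v j \<noteq> 0}"
    and proj: "\<And>T v. T \<subseteq> {..<N} \<Longrightarrow> card T < d \<Longrightarrow> v \<in> supp_vecs N \<Longrightarrow> \<exists>w\<in>D. \<forall>i\<in>T. w i = v i"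
  shows "\<exists>d'\<ge>d. EAQECC_exists CARD('a) N K d' (N + K - 2 * k)"
proof -
  define q c W where "q = CARD('a)" and "c = N + K - 2 * k" and "W = C \<inter> D"
  let ?L = "basis_labels q"
  let ?V = "supp_vecs N :: (nat \<Rightarrow> 'a) set"
  have W: "is_add_subgroup W" "W \<subseteq> C" "W \<subseteq> D" "card W = q ^ (k - K)"
    using C(1) D(1) CD by (auto simp: W_def q_def is_add_subgroup_Int)
  have fin: "finite C" "finite D" "finite W"
    using C(2) D(2) W(2) by (auto intro: finite_subset[OF _ finite_supp_vecs])
  have "card C = card (?L K) * card W"
    using C(3) K(2) unfolding W(4) card_basis_labels q_def by (simp flip: power_add)
  from coset_transversal[OF fin(1) C(1) W(1,2) finite_basis_labels this]
  obtain r where r': "\<forall>x\<in>?L K. r x \<in> C" "\<forall>x\<in>?L K. \<forall>x'\<in>?L K. r x - r x' \<in> W \<longrightarrow> x = x'"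
    by blast
  have r: "\<And>x. x \<in> ?L K \<Longrightarrow> r x \<in> C"
      "\<And>x x'. x \<in> ?L K \<Longrightarrow> x' \<in> ?L K \<Longrightarrow> r x - r x' \<in> W \<Longrightarrow> x = x'"
    using r' by blast+
  have "c + (k - K) = N - k" using K by (simp add: c_def)
  then have "card D = card (?L c) * card W"
    using D(3) unfolding W(4) card_basis_labels q_def by (simp flip: power_add)
  from coset_transversal[OF fin(2) D(1) W(1,3) finite_basis_labels this]
  obtain t where t': "\<forall>i\<in>?L c. t i \<in> D" "\<forall>i\<in>?L c. \<forall>i'\<in>?L c. t i - t i' \<in> W \<longrightarrow> i = i'"
      "\<forall>g\<in>D. \<exists>i\<in>?L c. g - t i \<in> W"
    by blast
  have t: "\<And>i. i \<in> ?L c \<Longrightarrow> t i \<in> D"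
      "\<And>i i'. i \<in> ?L c \<Longrightarrow> i' \<in> ?L c \<Longrightarrow> t i - t i' \<in> W \<Longrightarrow> i = i'"
      "\<And>g. g \<in> D \<Longrightarrow> \<exists>i\<in>?L c. g - t i \<in> W"
    using t' by blast+
  obtain \<phi> where \<phi>: "bij_betw \<phi> (UNIV :: 'a set) {..<q}"
    using ex_bij_betw_finite_nat[of "UNIV :: 'a set"] by (auto simp: atLeast0LessThan q_def)
  define enc where "enc v = map (\<lambda>i. \<phi> (v i)) [0..<N]" for v :: "nat \<Rightarrow> 'a"
  have enc: "bij_betw enc ?V (?L N)"
    using bij_betw_map_supp_vecs[OF \<phi>, of N] by (simp add: enc_def[abs_def])
  have Vadd: "v + w \<in> ?V" if "v \<in> ?V" "w \<in> ?V" for v w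
    using is_add_subgroup_add[OF is_add_subgroup_supp_vecs that] .
  have rV: "r x \<in> ?V" if "x \<in> ?L K" for x using r(1)[OF that] C(2) by blast
  have tV: "t i \<in> ?V" if "i \<in> ?L c" for i using t(1)[OF that] D(2) by blast
  have WV: "W \<subseteq> ?V" using W(2) C(2) by blast
  define S where "S x i = (\<lambda>w. enc (r x + t i + w)) ` W" for x i
  have inj: "inj_on (\<lambda>w. enc (r x + t i + w)) W" if "x \<in> ?L K" "i \<in> ?L c" for x i
  proof (rule inj_onI)
    fix w w' assume w: "w \<in> W" "w' \<in> W" and eq: "enc (r x + t i + w) = enc (r x + t i + w')"
    have "r x + t i + w \<in> ?V" "r x + t i + w' \<in> ?V"
      using w rV[OF that(1)] tV[OF that(2)] WV by (blast intro: Vadd)+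
    then have "r x + t i + w = r x + t i + w'" using enc eq by (metis bij_betw_inv_into_left)
    then show "w = w'" by simp
  qed
  have rtw: "r x + t i + w \<in> ?V" if "x \<in> ?L K" "i \<in> ?L c" "w \<in> W" for x i w
    using that rV tV WV by (blast intro: Vadd)
  have S: "\<exists>w\<in>W. y = enc (r x + t i + w) \<and> r x + t i + w \<in> ?V" if "x \<in> ?L K" "i \<in> ?L c" "y \<in> S x i" for x i y
    using that rtw unfolding S_def by blast
  have q1: "1 < q" using card_mono[of UNIV "{0, 1 :: 'a}"] by (simp add: q_def)
  interpret flat_ea_code q N K c "card W" S
  proof
    show "1 < q" by (rule q1)
    show "K + c \<le> N" using K by (simp add: c_def)
    show "0 < card W" using q1 W(4) by simp
    fix x i assume x: "x \<in> ?L K" and i: "i \<in> ?L c"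
    show "S x i \<subseteq> ?L N" using S[OF x i] enc by (auto simp: bij_betw_def)
    show "card (S x i) = card W" unfolding S_def by (rule card_image[OF inj[OF x i]])
    fix x' i' y assume x': "x' \<in> ?L K" and i': "i' \<in> ?L c" and y: "y \<in> S x i" "y \<in> S x' i'"
    obtain w where w: "w \<in> W" "y = enc (r x + t i + w)" "r x + t i + w \<in> ?V" using S[OF x i y(1)] by blast
    obtain w' where w': "w' \<in> W" "y = enc (r x' + t i' + w')" "r x' + t i' + w' \<in> ?V"
      using S[OF x' i' y(2)] by blast
    have eq: "r x + t i + w = r x' + t i' + w'"
      using w w' enc by (metis bij_betw_inv_into_left)
    \<comment> \<open>One side lies in \<open>C\<close>, the other in \<open>D\<close>, so both lie
      in \<open>W\<close>; distinct representatives never differ by an element of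
      \<open>W\<close>.\<close>
    have "r x - r x' = (t i' - t i) + (w' - w)"
      using eq by (simp add: algebra_simps)
    moreover have "(t i' - t i) + (w' - w) \<in> D"
      by (intro is_add_subgroup_add[OF D(1)] is_add_subgroup_diff[OF D(1)] t(1) i i')
        (use w(1) w'(1) W(3) in auto)
    moreover have "r x - r x' \<in> C" using C(1) r(1) x x' by (simp add: is_add_subgroup_def)
    ultimately have "r x - r x' \<in> W" by (simp add: W_def)
    then have 1: "x = x'" using r(2) x x' by blast
    then have "t i - t i' = w' - w" using eq by (simp add: algebra_simps)
    then have "t i - t i' \<in> W" using W(1) w(1) w'(1) by (simp add: is_add_subgroup_def)
    then show "x = x' \<and> i = i'" using 1 t(2) i i' by blast
  qed
  have "\<exists>d'\<ge>d. EAQECC_exists q N K d' c"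
  proof (rule EAQECC_existsI[OF K(1)])
    fix x x' i y y' assume x: "x \<in> ?L K" and x': "x' \<in> ?L K" and i: "i \<in> ?L c"
      and y: "y \<in> S x i" "y' \<in> S x' i" and less: "card {j. j < N \<and> y ! j \<noteq> y' ! j} < d"
    obtain w where w: "w \<in> W" "y = enc (r x + t i + w)" using S[OF x i y(1)] by blast
    obtain w' where w': "w' \<in> W" "y' = enc (r x' + t i + w')" using S[OF x' i y(2)] by blast
    \<comment> \<open>The common shift \<open>t i\<close> cancels, so the difference of the two
      labels is a word of \<open>C\<close>.\<close>
    let ?v = "(r x - r x') + (w - w')"
    have "?v \<in> C"
      by (intro is_add_subgroup_add[OF C(1)] is_add_subgroup_diff[OF C(1)] r(1) x x')
        (use w(1) w'(1) W(2) in auto)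
    moreover have "{j. j < N \<and> y ! j \<noteq> y' ! j} = {j. j < N \<and> ?v j \<noteq> 0}"
    proof -
      have "y ! j = y' ! j \<longleftrightarrow> ?v j = 0" if "j < N" for j
      proof -
        have "y ! j = y' ! j \<longleftrightarrow> (r x + t i + w) j = (r x' + t i + w') j"
          using that \<phi> by (simp add: w w' enc_def bij_betw_def inj_eq)
        also have "\<dots> \<longleftrightarrow> ?v j = 0" by (simp add: algebra_simps)
        finally show ?thesis .
      qed
      then show ?thesis by blast
    qed
    ultimately have "?v = 0" using dist[of ?v] less by force
    then have "r x + t i + w = r x' + t i + w'" by (simp add: algebra_simps)
    then show "y = y'" by (simp only: w w')
  next
    fix T x x' and g :: "nat list \<Rightarrow> complex"
    assume T: "T \<subseteq> {..<N}" "card T < d" and x: "x \<in> ?L K" "x' \<in> ?L K"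
    \<comment> \<open>The double sum runs over the coset of \<open>D\<close> through
      \<open>r x\<close>; the claim is that this shift is invisible on \<open>T\<close>.\<close>
    have "(\<Sum>i\<in>?L c. \<Sum>y\<in>S x i. g (nths y T)) = (\<Sum>v\<in>D. g (nths (enc v) T))" if x: "x \<in> ?L K" for x
    proof -
      have "(\<Sum>i\<in>?L c. \<Sum>y\<in>S x i. g (nths y T)) = (\<Sum>i\<in>?L c. \<Sum>w\<in>W. g (nths (enc (r x + t i + w)) T))"
        unfolding S_def by (intro sum.cong refl) (simp add: sum.reindex[OF inj[OF x]])
      also have "\<dots> = (\<Sum>(i, w)\<in>?L c \<times> W. g (nths (enc (r x + t i + w)) T))"
        by (simp add: sum.cartesian_product)
      also have "\<dots> = (\<Sum>v\<in>D. g (nths (enc (r x + v)) T))"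
      proof -
        have "bij_betw (\<lambda>(i, w). t i + w) (?L c \<times> W) D"
          unfolding bij_betw_def
        proof
          show "inj_on (\<lambda>(i, w). t i + w) (?L c \<times> W)"
          proof (rule inj_onI, clarify)
            fix i w i' w' assume *: "i \<in> ?L c" "w \<in> W" "i' \<in> ?L c" "w' \<in> W" "t i + w = t i' + w'"
            then have "t i - t i' = w' - w" by (simp add: algebra_simps)
            then have "i = i'" using * t(2) W(1) by (simp add: is_add_subgroup_def)
            then show "i = i' \<and> w = w'" using *(5) by simp
          qed
          show "(\<lambda>(i, w). t i + w) ` (?L c \<times> W) = D"
          proof
            show "(\<lambda>(i, w). t i + w) ` (?L c \<times> W) \<subseteq> D"
              using t(1) W(3) is_add_subgroup_add[OF D(1)] by auto
            show "D \<subseteq> (\<lambda>(i, w). t i + w) ` (?L c \<times> W)"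
            proof
              fix v assume "v \<in> D"
              then obtain i where "i \<in> ?L c" "v - t i \<in> W" using t(3) by blast
              then show "v \<in> (\<lambda>(i, w). t i + w) ` (?L c \<times> W)"
                by (intro image_eqI[where x = "(i, v - t i)"]) auto
            qed
          qed
        qed
        from sum.reindex_bij_betw[OF this, of "\<lambda>v. g (nths (enc (r x + v)) T)"]
        show ?thesis by (simp add: case_prod_unfold add.assoc)
      qed
      also have "\<dots> = (\<Sum>v\<in>D. g (nths (enc v) T))"
      proof -
        \<comment> \<open>Translating the summation over \<open>D\<close> by a word that agrees with
          \<open>r x\<close> on \<open>T\<close> makes the shift vanish on all coordinates that
          \<open>g\<close> sees.\<close>
        obtain w where w: "w \<in> D" "\<forall>i\<in>T. w i = r x i" using proj[OF T rV[OF x]] by blast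
        have "(\<Sum>v\<in>D. g (nths (enc (r x + v)) T)) = (\<Sum>v\<in>D. g (nths (enc (r x + (v - w))) T))"
          using D(1) w(1) is_add_subgroup_add[OF D(1)]
          by (intro sum.reindex_bij_witness[of _ "\<lambda>v. v - w" "\<lambda>v. v + w"]) (auto simp: is_add_subgroup_def)
        also have "\<dots> = (\<Sum>v\<in>D. g (nths (enc v) T))"
        proof (intro sum.cong refl arg_cong[of _ _ g])
          fix v
          show "nths (enc (r x + (v - w))) T = nths (enc v) T"
            unfolding enc_def nths_map using w(2) by (auto simp: set_nths)
        qed
        finally show ?thesis .
      qed
      finally show ?thesis .
    qed
    then show "(\<Sum>i\<in>?L c. \<Sum>y\<in>S x i. g (nths y T)) = (\<Sum>i\<in>?L c. \<Sum>y\<in>S x' i. g (nths y T))"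
      using x by simp
  qed
  then show ?thesis by (simp add: q_def c_def)
qed

section \<open>Extended generalized Reed-Solomon codes\<close>

definition lagrange_poly :: "nat set \<Rightarrow> (nat \<Rightarrow> 'a::field) \<Rightarrow> nat \<Rightarrow> 'a poly" where
  "lagrange_poly J b j = (\<Prod>v\<in>J - {j}. smult (inverse (b j - b v)) [:- b v, 1:])"

lemma poly_lagrange_poly:
  assumes "finite J" "inj_on b J" "i \<in> J" "j \<in> J"
  shows "poly (lagrange_poly J b j) (b i) = of_bool (i = j)"
proof (cases "i = j")
  case True
  have "poly (smult (inverse (b j - b v)) [:- b v, 1:]) (b j) = 1" if "v \<in> J - {j}" for v
  proof -
    have "b j \<noteq> b v" using assms that by (auto simp: inj_on_def)
    then have "inverse (b j - b v) * (b j - b v) = 1" by simp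
    then show ?thesis by (simp add: algebra_simps)
  qed
  then show ?thesis using True by (simp add: lagrange_poly_def poly_prod)
next
  case False
  then show ?thesis using assms by (auto simp: lagrange_poly_def poly_prod)
qed

lemma degree_lagrange_poly:
  assumes "finite J" "j \<in> J"
  shows "degree (lagrange_poly J b j) < card J"
proof -
  have "degree (lagrange_poly J b j) \<le> (\<Sum>v\<in>J - {j}. 1)"
    unfolding lagrange_poly_def using assms
    by (intro order.trans[OF degree_prod_sum_le] sum_mono) (auto simp: o_def)
  also have "\<dots> = card J - 1" using assms by simp
  finally show ?thesis using assms card_gt_0_iff[of J] by force
qed

lemma coeff_lagrange_poly:
  assumes "finite J" "inj_on b J" "j \<in> J"
  shows "coeff (lagrange_poly J b j) (card J - 1) = (\<Prod>v\<in>J - {j}. inverse (b j - b v))"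
proof -
  have ne: "b j \<noteq> b v" if "v \<in> J - {j}" for v using assms that by (auto simp: inj_on_def)
  then have "degree (lagrange_poly J b j) = (\<Sum>v\<in>J - {j}. degree (smult (inverse (b j - b v)) [:- b v, 1:]))"
    unfolding lagrange_poly_def by (intro degree_prod_sum_eq) auto
  also have "\<dots> = (\<Sum>v\<in>J - {j}. 1)" using ne by (intro sum.cong) auto
  finally have "degree (lagrange_poly J b j) = card J - 1" using assms by simp
  moreover have "lead_coeff (lagrange_poly J b j) = (\<Prod>v\<in>J - {j}. inverse (b j - b v))"
    unfolding lagrange_poly_def lead_coeff_prod lead_coeff_smult by simp
  ultimately show ?thesis by metis
qed

lemma lagrange_interpolation:
  fixes P :: "'a::field poly"
  assumes "finite J" "inj_on b J" "degree P < card J"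
  shows "P = (\<Sum>j\<in>J. smult (poly P (b j)) (lagrange_poly J b j))"
proof (rule poly_eqI_degree[where A = "b ` J"])
  fix x assume "x \<in> b ` J"
  then obtain i where i: "i \<in> J" "x = b i" by blast
  have "poly (\<Sum>j\<in>J. smult (poly P (b j)) (lagrange_poly J b j)) (b i) = (\<Sum>j\<in>J. if j = i then poly P (b i) else 0)"
    unfolding poly_sum using assms i by (intro sum.cong refl) (auto simp: poly_lagrange_poly)
  then show "poly P x = poly (\<Sum>j\<in>J. smult (poly P (b j)) (lagrange_poly J b j)) x"
    using assms i by simp
next
  have pos: "0 < card J" using assms(3) by simp
  show "degree P < card (b ` J)" using assms by (simp add: card_image)
  have "degree (\<Sum>j\<in>J. smult (poly P (b j)) (lagrange_poly J b j)) < card J"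
    using assms degree_lagrange_poly by (intro degree_sum_less) (auto intro: le_less_trans[OF degree_smult_le] simp: pos simp del: degree_smult_eq)
  then show "degree (\<Sum>j\<in>J. smult (poly P (b j)) (lagrange_poly J b j)) < card (b ` J)"
    using assms by (simp add: card_image)
qed

text \<open>Coefficients of x^(n-1) are compared in the interpolation formula, where each Lagrange
  polynomial contributes its leading coefficient. This turns weighted sums over the points into a
  single coefficient.\<close>

lemma sum_lagrange_weights:
  fixes P :: "'a::field poly"
  assumes "inj_on b {..<n}" "degree P < n"
  shows "(\<Sum>j<n. (\<Prod>v\<in>{..<n} - {j}. inverse (b j - b v)) * poly P (b j)) = coeff P (n - 1)"
proof -
  have "coeff P (n - 1) = (\<Sum>j<n. poly P (b j) * coeff (lagrange_poly {..<n} b j) (n - 1))"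
    using lagrange_interpolation[of "{..<n}" b P] assms by (metis (no_types, lifting) card_lessThan coeff_smult coeff_sum finite_lessThan sum.cong)
  also have "\<dots> = (\<Sum>j<n. (\<Prod>v\<in>{..<n} - {j}. inverse (b j - b v)) * poly P (b j))"
    using coeff_lagrange_poly[of "{..<n}" b] assms(1) by (intro sum.cong) auto
  finally show ?thesis by simp
qed

text \<open>The coefficients of the Lagrange polynomials are the entries of the inverse Vandermonde
  matrix, so they solve the moment equations.\<close>

lemma moments_surj:
  fixes b :: "nat \<Rightarrow> 'a::field"
  assumes "finite J" "inj_on b J"
  shows "\<exists>y. (\<forall>j. j \<notin> J \<longrightarrow> y j = 0) \<and> (\<forall>i<card J. (\<Sum>j\<in>J. y j * b j ^ i) = r i)"
proof (intro exI conjI allI impI)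
  let ?y = "\<lambda>j. if j \<in> J then \<Sum>m<card J. r m * coeff (lagrange_poly J b j) m else 0"
  fix i assume i: "i < card J"
  have eq: "(\<Sum>j\<in>J. b j ^ i * coeff (lagrange_poly J b j) m) = of_bool (m = i)" for m
  proof -
    have "degree (monom 1 i :: 'a poly) < card J" using i by (simp add: degree_monom_eq)
    from lagrange_interpolation[OF assms this]
    have "coeff (monom 1 i) m = coeff (\<Sum>j\<in>J. smult (b j ^ i) (lagrange_poly J b j)) m"
      by (simp add: poly_monom)
    then show ?thesis by (auto simp: coeff_sum)
  qed
  have "(\<Sum>j\<in>J. ?y j * b j ^ i) = (\<Sum>j\<in>J. \<Sum>m<card J. r m * (b j ^ i * coeff (lagrange_poly J b j) m))"
    by (intro sum.cong refl) (simp add: sum_distrib_left mult_ac)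
  also have "\<dots> = (\<Sum>m<card J. r m * (\<Sum>j\<in>J. b j ^ i * coeff (lagrange_poly J b j) m))"
    by (subst sum.swap) (simp add: sum_distrib_left)
  also have "\<dots> = (\<Sum>m<card J. if m = i then r i else 0)" by (intro sum.cong refl) (simp add: eq)
  also have "\<dots> = r i" using i by simp
  finally show "(\<Sum>j\<in>J. ?y j * b j ^ i) = r i" .
qed auto

text \<open>The map \<open>x \<mapsto> x\<^sup>t - x\<^sup>t\<^sup>-\<^sup>1\<close> has equal values at 0 and 1, so it misses some element \<open>e\<close>.\<close>

lemma exists_poly_without_roots:
  assumes "2 \<le> t"
  shows "\<exists>p :: 'a::{field,finite} poly. degree p = t \<and> (\<forall>x. poly p x \<noteq> 0)"
proof -
  let ?f = "\<lambda>x :: 'a. x ^ t - x ^ (t - 1)"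
  have "\<not> inj ?f"
  proof
    assume "inj ?f"
    from injD[OF this, of 0 1] assms show False by (simp add: power_0_left)
  qed
  then have "\<not> surj ?f" using finite_UNIV_surj_inj[of ?f] by auto
  then obtain e where "e \<notin> range ?f" by blast
  then have e: "?f x \<noteq> e" for x by blast
  define p where "p = monom 1 t + (- monom 1 (t - 1) - [:e:])"
  have "degree p = t"
    unfolding p_def using assms
    by (subst degree_add_eq_left)
      (auto simp: degree_monom_eq intro!: degree_diff_less le_less_trans[OF degree_minus[THEN eq_refl]])
  moreover have "poly p x \<noteq> 0" for x
    using e[of x] by (auto simp: p_def poly_monom algebra_simps)
  ultimately show ?thesis by blast
qed

section \<open>Polynomials of bounded degree\<close>

text \<open>Bounding by coefficients instead of \<open>degree f < k\<close> leaves exactly the zero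
  polynomial for \<open>k = 0\<close>, so the count \<open>CARD('a) ^ k\<close> holds there as
  well.\<close>

definition polys_below :: "nat \<Rightarrow> 'a::zero poly set" where
  "polys_below k = {f. \<forall>i\<ge>k. coeff f i = 0}"

lemma polys_below_degree: "f \<in> polys_below k \<Longrightarrow> 0 < k \<Longrightarrow> degree f < k"
  unfolding polys_below_def by (metis (mono_tags) degree_0 leading_coeff_0_iff mem_Collect_eq not_le)

lemma card_polys_below: "card (polys_below k :: 'a::{zero,finite} poly set) = CARD('a) ^ k"
proof -
  have "bij_betw coeff (polys_below k) (supp_vecs k :: (nat \<Rightarrow> 'a) set)"
    unfolding bij_betw_def
  proof
    show "inj_on coeff (polys_below k :: 'a poly set)" by (auto simp: inj_on_def poly_eq_iff)
    show "coeff ` polys_below k = (supp_vecs k :: (nat \<Rightarrow> 'a) set)"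
    proof
      show "coeff ` polys_below k \<subseteq> (supp_vecs k :: (nat \<Rightarrow> 'a) set)"
        by (auto simp: polys_below_def supp_vecs_def)
      show "(supp_vecs k :: (nat \<Rightarrow> 'a) set) \<subseteq> coeff ` polys_below k"
      proof
        fix v :: "nat \<Rightarrow> 'a" assume v: "v \<in> supp_vecs k"
        then have "coeff (Abs_poly v) = v"
          by (intro coeff_Abs_poly[of k]) (auto simp: supp_vecs_def)
        then show "v \<in> coeff ` polys_below k"
          using v by (intro image_eqI[where x = "Abs_poly v"]) (auto simp: polys_below_def supp_vecs_def)
      qed
    qed
  qed
  from bij_betw_same_card[OF this] show ?thesis by (simp add: card_supp_vecs)
qed

section \<open>The two extended codes\<close>

text \<open>\<open>b\<close> holds the evaluation points, \<open>z\<close> the column multipliers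
  and \<open>\<gamma>\<close> the weights on the \<open>s\<close> extension coordinates. By
  \<open>0 < s\<close> coordinate \<open>n\<close> exists; it carries the top coefficient, and its
  weight \<open>\<gamma> 0\<close> is nonzero.\<close>

locale extended_grs_pair =
  fixes b z \<gamma> :: "nat \<Rightarrow> 'a::{field,finite}" and n s k :: nat
  assumes inj: "inj_on b {..<n}" and z: "\<And>j. j < n \<Longrightarrow> z j \<noteq> 0" and \<gamma>: "\<gamma> 0 \<noteq> 0"
    and s: "0 < s" and k: "2 \<le> k" "k \<le> n"
begin

definition encode :: "'a poly \<Rightarrow> nat \<Rightarrow> 'a" where
  "encode f j = (if j < n then z j * poly f (b j)
     else if j < n + s then coeff f (k - 1 - (j - n)) else 0)"

text \<open>The \<open>i\<close>-th check pairs \<open>v\<close> with the word of x^i in a code with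
  multipliers 1 and extension coordinates weighted by \<open>\<gamma>\<close>, where the coefficient
  of x^i sits at \<open>n + (k - 1 - i)\<close>. Hence \<open>D\<close> is the dual of such a
  code.\<close>

definition syndrome :: "(nat \<Rightarrow> 'a) \<Rightarrow> nat \<Rightarrow> 'a" where
  "syndrome v i = (\<Sum>j<n. v j * b j ^ i) +
     (if k - 1 - i < s then \<gamma> (k - 1 - i) * v (n + (k - 1 - i)) else 0)"

definition C :: "(nat \<Rightarrow> 'a) set" where "C = encode ` polys_below k"

definition D :: "(nat \<Rightarrow> 'a) set" where "D = {v \<in> supp_vecs (n + s). \<forall>i<k. syndrome v i = 0}"

lemma encode_diff: "encode (f - g) = encode f - encode g"
  by (auto simp: encode_def fun_eq_iff algebra_simps)

lemma encode_zero: "encode 0 = 0"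
  by (simp add: encode_def fun_eq_iff)

lemma syndrome_diff: "syndrome (v - w) i = syndrome v i - syndrome w i"
  by (simp add: syndrome_def algebra_simps sum_subtractf)

lemma syndrome_add: "syndrome (v + w) i = syndrome v i + syndrome w i"
  by (simp add: syndrome_def algebra_simps sum.distrib)

lemma is_add_subgroup_D: "is_add_subgroup D"
  using is_add_subgroup_supp_vecs[of "n + s"]
  by (auto simp: is_add_subgroup_def D_def syndrome_diff) (simp add: syndrome_def)

lemma C_subset: "C \<subseteq> supp_vecs (n + s)"
  by (auto simp: C_def supp_vecs_def encode_def)

lemma polys_below_diff: "f \<in> polys_below k \<Longrightarrow> g \<in> polys_below k \<Longrightarrow> f - g \<in> polys_below k"
  by (simp add: polys_below_def)

lemma is_add_subgroup_C: "is_add_subgroup C"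
proof -
  have "0 \<in> C" using encode_zero unfolding C_def by (intro image_eqI[where x = 0]) (simp_all add: polys_below_def)
  moreover have "encode f - encode g \<in> C" if "f \<in> polys_below k" "g \<in> polys_below k" for f g
    unfolding C_def encode_diff[symmetric] using that by (blast intro: polys_below_diff)
  ultimately show ?thesis unfolding is_add_subgroup_def by (auto simp: C_def)
qed

text \<open>A polynomial of degree \<open>k - 1\<close> may have that many roots, but then
  coordinate \<open>n\<close> is nonzero; any other has at most \<open>k - 2\<close> roots. This
  gains one over the bound \<open>n - k + 1\<close> of the unextended code.\<close>

lemma weight_encode:
  assumes f: "f \<in> polys_below k" "f \<noteq> 0"
  shows "n - k + 2 \<le> card {j. j < n + s \<and> encode f j \<noteq> 0}"
proof -
  define Z where "Z = {j. j < n \<and> poly f (b j) = 0}"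
  have deg: "degree f < k" using polys_below_degree[OF f(1)] k by simp
  have "card Z = card (b ` Z)" using inj by (intro card_image[symmetric]) (auto simp: inj_on_def Z_def)
  also have "\<dots> \<le> card {x. poly f x = 0}"
    using f(2) by (intro card_mono poly_roots_finite) (auto simp: Z_def)
  also have "\<dots> \<le> degree f" using f(2) by (rule card_poly_roots_bound)
  finally have Z: "card Z \<le> degree f" .
  have card: "card ({..<n} - Z) = n - card Z" by (subst card_Diff_subset) (auto simp: Z_def)
  have sub: "{..<n} - Z \<subseteq> {j. j < n + s \<and> encode f j \<noteq> 0}" using z by (auto simp: Z_def encode_def)
  show ?thesis
  proof (cases "degree f = k - 1")
    case True
    then have "coeff f (k - 1) \<noteq> 0" using f(2) by (metis leading_coeff_0_iff)
    then have "insert n ({..<n} - Z) \<subseteq> {j. j < n + s \<and> encode f j \<noteq> 0}"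
      using sub s by (auto simp: encode_def)
    then have "card (insert n ({..<n} - Z)) \<le> card {j. j < n + s \<and> encode f j \<noteq> 0}"
      by (intro card_mono) auto
    then show ?thesis using card Z True k by simp
  next
    case False
    have "card ({..<n} - Z) \<le> card {j. j < n + s \<and> encode f j \<noteq> 0}"
      using sub by (intro card_mono) auto
    then show ?thesis using card Z False deg k by linarith
  qed
qed

lemma inj_on_encode: "inj_on encode (polys_below k)"
proof (rule inj_onI, rule ccontr)
  fix f g assume *: "f \<in> polys_below k" "g \<in> polys_below k" "encode f = encode g" "f \<noteq> g"
  then have "encode (f - g) = 0" by (simp add: encode_diff)
  then show False using weight_encode[OF polys_below_diff[OF *(1,2)]] *(4) by simp
qed

lemma card_C: "card C = CARD('a) ^ k"
  unfolding C_def by (simp add: card_image[OF inj_on_encode] card_polys_below)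

text \<open>If \<open>T\<close> leaves \<open>k\<close> evaluation points free, moments suffice.
  Otherwise \<open>T\<close> consists of \<open>n - k + 1\<close> of the first \<open>n\<close>
  coordinates; the \<open>k - 1\<close> free points settle the checks below \<open>k - 1\<close>,
  and coordinate \<open>n\<close>, which is free and enters only the last check, settles that
  one.\<close>

lemma syndrome_surj_off:
  assumes T: "T \<subseteq> {..<n + s}" "card T < n - k + 2"
  shows "\<exists>y\<in>supp_vecs (n + s). (\<forall>i\<in>T. y i = 0) \<and> (\<forall>i<k. syndrome y i = r i)"
proof -
  define A where "A = {..<n} - T"
  have finT: "finite T" using T(1) finite_subset by blast
  have cardA: "card A = n - card ({..<n} \<inter> T)" by (simp add: A_def card_Diff_subset_Int)
  have injA: "inj_on b J" if "J \<subseteq> A" for J using inj that by (auto simp: A_def inj_on_def)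
  have sumA: "(\<Sum>j<n. y j * b j ^ i) = (\<Sum>j\<in>J. y j * b j ^ i)"
    if "J \<subseteq> A" "\<forall>j. j < n \<longrightarrow> j \<notin> J \<longrightarrow> y j = 0" for J y i
    using that by (intro sum.mono_neutral_right) (auto simp: A_def)
  show ?thesis
  proof (cases "k \<le> card A")
    case True
    then obtain J where J: "J \<subseteq> A" "card J = k" "finite J" by (rule obtain_subset_with_card_n)
    obtain y where y: "\<forall>j. j \<notin> J \<longrightarrow> y j = 0" "\<forall>i<k. (\<Sum>j\<in>J. y j * b j ^ i) = r i"
      using moments_surj[OF J(3) injA[OF J(1)], of r] J(2) by auto
    have "syndrome y i = r i" if "i < k" for i
    proof -
      have *: "y (n + m) = 0" for m using y(1) J(1) by (auto simp: A_def)
      have "syndrome y i = (\<Sum>j<n. y j * b j ^ i)" unfolding syndrome_def * by simp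
      then show ?thesis using y that sumA[OF J(1), of y] by simp
    qed
    moreover have "y \<in> supp_vecs (n + s)" "\<forall>i\<in>T. y i = 0"
      using y(1) J(1) by (auto simp: supp_vecs_def A_def subset_iff)
    ultimately show ?thesis by blast
  next
    case False
    have "card ({..<n} \<inter> T) \<le> card T" using finT by (intro card_mono) auto
    then have "card ({..<n} \<inter> T) = card T" "card A = k - 1" using cardA False T(2) k by linarith+
    then have "{..<n} \<inter> T = T" using finT by (intro card_subset_eq) auto
    then have nT: "n \<notin> T" by auto
    obtain y where y: "\<forall>j. j \<notin> A \<longrightarrow> y j = 0" "\<forall>i<k - 1. (\<Sum>j\<in>A. y j * b j ^ i) = r i"
      using moments_surj[of A b r] injA[of A] \<open>card A = k - 1\<close> by (auto simp: A_def)
    define c where "c = (r (k - 1) - (\<Sum>j\<in>A. y j * b j ^ (k - 1))) / \<gamma> 0"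
    have "syndrome (y(n := c)) i = r i" if "i < k" for i
    proof -
      have "(\<Sum>j<n. (y(n := c)) j * b j ^ i) = (\<Sum>j\<in>A. y j * b j ^ i)"
        using sumA[of A y i] y(1) by simp
      moreover have "(y(n := c)) (n + m) = (if m = 0 then c else 0)" for m
        using y(1) by (auto simp: A_def)
      ultimately have *: "syndrome (y(n := c)) i = (\<Sum>j\<in>A. y j * b j ^ i) +
          (if k - 1 - i < s then \<gamma> (k - 1 - i) * (if k - 1 - i = 0 then c else 0) else 0)"
        unfolding syndrome_def by presburger
      show ?thesis
      proof (cases "i = k - 1")
        case True
        then show ?thesis unfolding * using s \<gamma> by (simp add: c_def)
      next
        case False
        then show ?thesis unfolding * using y(2) that by auto
      qed
    qed
    moreover have "y(n := c) \<in> supp_vecs (n + s)" "\<forall>i\<in>T. (y(n := c)) i = 0"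
      using y(1) s nT by (auto simp: supp_vecs_def A_def)
    ultimately show ?thesis by blast
  qed
qed

text \<open>A section \<open>sec\<close> of the syndrome map splits the whole space into the product
  of all syndromes with the kernel \<open>D\<close>.\<close>

lemma card_D: "card D = CARD('a) ^ (n + s - k)"
proof -
  have "\<exists>y\<in>supp_vecs (n + s). \<forall>i<k. syndrome y i = r i" for r
    using syndrome_surj_off[of "{}" r] k by auto
  then obtain sec where sec: "\<And>r. sec r \<in> supp_vecs (n + s)" "\<And>r i. i < k \<Longrightarrow> syndrome (sec r) i = r i"
    by metis
  let ?V = "supp_vecs (n + s) :: (nat \<Rightarrow> 'a) set"
  let ?syn = "\<lambda>v i. if i < k then syndrome v i else 0"
  have syn: "?syn (sec r + y) = r" if "r \<in> supp_vecs k" "y \<in> D" for r y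
    using that by (auto simp: fun_eq_iff syndrome_add sec(2) D_def supp_vecs_def)
  have "bij_betw (\<lambda>(r, y). sec r + y) (supp_vecs k \<times> D) ?V"
  proof (rule bij_betw_byWitness[where f' = "\<lambda>v. (?syn v, v - sec (?syn v))"])
    show "\<forall>p\<in>supp_vecs k \<times> D. (\<lambda>v. (?syn v, v - sec (?syn v))) ((\<lambda>(r, y). sec r + y) p) = p"
    proof
      fix p :: "(nat \<Rightarrow> 'a) \<times> (nat \<Rightarrow> 'a)" assume "p \<in> supp_vecs k \<times> D"
      then obtain r y where p: "p = (r, y)" "r \<in> supp_vecs k" "y \<in> D" by blast
      show "(\<lambda>v. (?syn v, v - sec (?syn v))) ((\<lambda>(r, y). sec r + y) p) = p"
        unfolding p(1) prod.case syn[OF p(2,3)] by simp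
    qed
    show "\<forall>v\<in>?V. (\<lambda>(r, y). sec r + y) (?syn v, v - sec (?syn v)) = v" by simp
    show "(\<lambda>(r, y). sec r + y) ` (supp_vecs k \<times> D) \<subseteq> ?V"
      using sec(1) is_add_subgroup_add[OF is_add_subgroup_supp_vecs[of "n + s"]] by (auto simp: D_def)
    show "(\<lambda>v. (?syn v, v - sec (?syn v))) ` ?V \<subseteq> supp_vecs k \<times> D"
      using sec(1) is_add_subgroup_diff[OF is_add_subgroup_supp_vecs[of "n + s"]]
      by (auto simp: D_def syndrome_diff sec(2) supp_vecs_def[of k])
  qed
  from bij_betw_same_card[OF this]
  have "CARD('a) ^ k * card D = CARD('a) ^ (n + s)"
    by (simp add: card_cartesian_product card_supp_vecs)
  also have "\<dots> = CARD('a) ^ k * CARD('a) ^ (n + s - k)" using k by (simp flip: power_add)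
  finally show ?thesis by simp
qed

text \<open>Subtracting from \<open>v\<close> a vector that has the same syndrome and vanishes on
  \<open>T\<close> lands in \<open>D\<close> without changing \<open>v\<close> on
  \<open>T\<close>.\<close>

lemma D_projects:
  assumes T: "T \<subseteq> {..<n + s}" "card T < n - k + 2" and v: "v \<in> supp_vecs (n + s)"
  shows "\<exists>w\<in>D. \<forall>i\<in>T. w i = v i"
proof -
  obtain y where y: "y \<in> supp_vecs (n + s)" "\<forall>i\<in>T. y i = 0" "\<forall>i<k. syndrome y i = syndrome v i"
    using syndrome_surj_off[OF T, of "syndrome v"] by blast
  have "v - y \<in> D"
    using y v is_add_subgroup_diff[OF is_add_subgroup_supp_vecs v y(1)] by (simp add: D_def syndrome_diff)
  then show ?thesis using y(2) by (intro bexI[of _ "v - y"]) auto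
qed

text \<open>The condition inside \<open>radical\<close> is membership of \<open>encode f\<close> in
  \<open>D\<close>. A radical of dimension \<open>k - R\<close> thus encodes to
  \<open>C \<inter> D\<close>, which leaves \<open>R\<close> logical qudits.\<close>

lemma EAQECC_exists_of_gram_radical:
  assumes R: "0 < R" "R \<le> k" "2 * k \<le> n + s + R"
    and radical: "\<And>f. f \<in> polys_below k \<Longrightarrow>
      (\<forall>i<k. (\<Sum>j<n. z j * poly f (b j) * b j ^ i) + (if k - 1 - i < s then \<gamma> (k - 1 - i) * coeff f i else 0) = 0)
      \<longleftrightarrow> f \<in> polys_below (k - R)"
  shows "\<exists>d\<ge>n - k + 2. EAQECC_exists CARD('a) (n + s) R d (n + s + R - 2 * k)"
proof (rule EAQECC_from_code_pair[OF is_add_subgroup_C C_subset card_C is_add_subgroup_D _ card_D])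
  show "D \<subseteq> supp_vecs (n + s)" by (auto simp: D_def)
  have enc: "encode f \<in> D \<longleftrightarrow> f \<in> polys_below (k - R)" if f: "f \<in> polys_below k" for f
  proof -
    have "syndrome (encode f) i = (\<Sum>j<n. z j * poly f (b j) * b j ^ i)
        + (if k - 1 - i < s then \<gamma> (k - 1 - i) * coeff f i else 0)" if "i < k" for i
    proof -
      have *: "encode f (n + m) = (if m < s then coeff f (k - 1 - m) else 0)" for m
        by (simp add: encode_def)
      have "k - 1 - (k - 1 - i) = i" using that by simp
      then show ?thesis unfolding syndrome_def * by (simp add: encode_def)
    qed
    moreover have "encode f \<in> supp_vecs (n + s)" using C_subset f by (auto simp: C_def)
    ultimately show ?thesis using radical[OF f] by (simp add: D_def)
  qed
  have sub: "polys_below (k - R) \<subseteq> (polys_below k :: 'a poly set)" by (auto simp: polys_below_def)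
  have "C \<inter> D = encode ` polys_below (k - R)"
    unfolding C_def using enc sub by blast
  then show "card (C \<inter> D) = CARD('a) ^ (k - R)"
    using card_image[OF inj_on_subset[OF inj_on_encode sub]] by (simp add: card_polys_below)
  show "n - k + 2 \<le> card {j. j < n + s \<and> v j \<noteq> 0}" if v: "v \<in> C" "v \<noteq> 0" for v
  proof -
    obtain f where f: "f \<in> polys_below k" "v = encode f" using v(1) by (auto simp: C_def)
    moreover from f v(2) have "f \<noteq> 0" by (auto simp: encode_zero)
    ultimately show ?thesis using weight_encode by simp
  qed
  show "k \<le> n + s" using k by simp
qed (use R D_projects in auto)

end

section \<open>Prescribing the dimension of the radical\<close>

text \<open>With the bare Lagrange weights as multipliers the sums are coefficients of x^i f in
  degree \<open>n - 1\<close>, which vanish except possibly in the corner \<open>i = k - 1\<close>,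
  \<open>n = 2 * k - 1\<close>. The matrix is then diagonal, and \<open>\<gamma>\<close> is nonzero
  on exactly \<open>R\<close> extension coordinates.\<close>

lemma exists_EAQECC_small_rank:
  fixes b :: "nat \<Rightarrow> 'a::{field,finite}"
  assumes "2 < CARD('a)" and b: "inj_on b {..<n}" and hk: "2 \<le> k" "2 * k \<le> n + 1"
    and R: "1 \<le> R" "R \<le> s" "R \<le> k"
  shows "\<exists>d\<ge>n - k + 2. EAQECC_exists CARD('a) (n + s) R d (n + s + R - 2 * k)"
proof -
  \<comment> \<open>\<open>c\<close> will be the weight of the top coefficient. It must be nonzero,
    and \<open>1 + c\<close> is the diagonal entry when the corner contributes, so -1 is avoided
    too.\<close>
  have "\<exists>c :: 'a. c \<notin> {0, - 1}"
  proof (rule ccontr)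
    assume "\<nexists>c :: 'a. c \<notin> {0, - 1}"
    then have "CARD('a) \<le> card {0, - 1 :: 'a}" by (intro card_mono) auto
    also have "\<dots> \<le> 2" by (simp add: card_insert_if)
    finally show False using assms(1) by simp
  qed
  then obtain c :: 'a where c: "c \<noteq> 0" "1 + c \<noteq> 0" by (metis add.commute insertCI add_eq_0_iff)
  define z where "z j = (\<Prod>v\<in>{..<n} - {j}. inverse (b j - b v))" for j
  define \<gamma> where "\<gamma> m = (if m = 0 then c else of_bool (m < R))" for m
  interpret extended_grs_pair b z \<gamma> n s k
  proof
    show "z j \<noteq> 0" if "j < n" for j using that b by (auto simp: z_def inj_on_def)
  qed (use b c hk R in \<open>auto simp: \<gamma>_def\<close>)
  show ?thesis
  proof (rule EAQECC_exists_of_gram_radical)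
    fix f :: "'a poly" assume f: "f \<in> polys_below k"
    have 1: "(\<Sum>j<n. z j * poly f (b j) * b j ^ i) = of_bool (i = k - 1 \<and> n = 2 * k - 1) * coeff f i" if i: "i < k" for i
    proof -
      have "degree (monom 1 i * f) \<le> i + degree f"
        by (rule order.trans[OF degree_mult_le]) (simp add: degree_monom_eq)
      then have "degree (monom 1 i * f) < n" using polys_below_degree[OF f] i hk by simp
      from sum_lagrange_weights[OF b this]
      have "(\<Sum>j<n. z j * poly f (b j) * b j ^ i) = coeff (monom 1 i * f) (n - 1)"
        by (simp add: z_def poly_monom mult_ac)
      also have "\<dots> = (if n - 1 < i then 0 else coeff f (n - 1 - i))" by (simp add: coeff_monom_mult)
      also have "\<dots> = of_bool (i = k - 1 \<and> n = 2 * k - 1) * coeff f i"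
      proof (cases "i = k - 1 \<and> n = 2 * k - 1")
        case True
        then have "n - 1 - i = i" "\<not> n - 1 < i" using hk by auto
        then show ?thesis using True by simp
      next
        case False
        then have "k \<le> n - 1 - i" using i hk by linarith
        then show ?thesis using False f by (auto simp: polys_below_def)
      qed
      finally show ?thesis .
    qed
    have "((\<Sum>j<n. z j * poly f (b j) * b j ^ i) + (if k - 1 - i < s then \<gamma> (k - 1 - i) * coeff f i else 0) = 0)
        \<longleftrightarrow> (k - R \<le> i \<longrightarrow> coeff f i = 0)" if i: "i < k" for i
    proof (cases "i = k - 1")
      case True
      have "(of_bool (n = 2 * k - 1) + c) * coeff f i = 0 \<longleftrightarrow> coeff f i = 0" using c by auto
      moreover have "k - R \<le> i" using True R by linarith
      ultimately show ?thesis using True R hk unfolding 1[OF i] by (simp add: \<gamma>_def algebra_simps)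
    next
      case False
      then have "0 < k - 1 - i" using i by simp
      moreover have "k - R \<le> i \<longleftrightarrow> k - 1 - i < R" using i R by linarith
      ultimately show ?thesis using False R unfolding 1[OF i] by (auto simp: \<gamma>_def)
    qed
    then have "(\<forall>i<k. (\<Sum>j<n. z j * poly f (b j) * b j ^ i) + (if k - 1 - i < s then \<gamma> (k - 1 - i) * coeff f i else 0) = 0)
      \<longleftrightarrow> (\<forall>i<k. k - R \<le> i \<longrightarrow> coeff f i = 0)" by blast
    also have "\<dots> \<longleftrightarrow> f \<in> polys_below (k - R)"
      using f by (auto simp: polys_below_def) (metis not_le)
    finally show "(\<forall>i<k. (\<Sum>j<n. z j * poly f (b j) * b j ^ i) + (if k - 1 - i < s then \<gamma> (k - 1 - i) * coeff f i else 0) = 0)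
      \<longleftrightarrow> f \<in> polys_below (k - R)" .
  qed (use hk R in auto)
qed

text \<open>A rootless \<open>p\<close> can be multiplied into the multipliers without creating
  zeros. The sums become coefficients of x^i p f in degree \<open>n - 1\<close>, and the degree of
  \<open>p\<close> decides from which degree of \<open>f\<close> on some test monomial reaches that
  position.\<close>

lemma exists_EAQECC_large_rank:
  fixes b :: "nat \<Rightarrow> 'a::{field,finite}"
  assumes b: "inj_on b {..<n}" and hk: "2 \<le> k" "2 * k \<le> n + 1" and s: "0 < s" and R: "3 \<le> R" "R \<le> k"
  shows "\<exists>d\<ge>n - k + 2. EAQECC_exists CARD('a) (n + s) R d (n + s + R - 2 * k)"
proof -
  \<comment> \<open>\<open>t\<close> solves \<open>(k - 1) + t + (k - R) = n - 1\<close>: the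
    smallest degree outside the radical is met by the largest test exponent.
    \<open>3 \<le> R\<close> and \<open>2 * k \<le> n + 1\<close> give
    \<open>2 \<le> t\<close>.\<close>
  define t where "t = n + R - 2 * k"
  have t: "2 \<le> t" "t + 2 * k = n + R" using hk R by (auto simp: t_def)
  obtain p :: "'a poly" where p: "degree p = t" "\<And>x. poly p x \<noteq> 0"
    using exists_poly_without_roots[OF t(1)] by blast
  define z where "z j = (\<Prod>v\<in>{..<n} - {j}. inverse (b j - b v)) * poly p (b j)" for j
  define \<gamma> :: "nat \<Rightarrow> 'a" where "\<gamma> m = of_bool (m = 0)" for m
  interpret extended_grs_pair b z \<gamma> n s k
  proof
    show "z j \<noteq> 0" if "j < n" for j using that b p(2) by (auto simp: z_def inj_on_def)
  qed (use b hk s in \<open>auto simp: \<gamma>_def\<close>)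
  show ?thesis
  proof (rule EAQECC_exists_of_gram_radical)
    fix f :: "'a poly" assume f: "f \<in> polys_below k"
    have sum: "(\<Sum>j<n. z j * poly f (b j) * b j ^ i) = coeff (monom 1 i * (p * f)) (n - 1)"
      if "i + t + degree f < n" for i
    proof -
      have "degree (monom 1 i * (p * f)) \<le> i + (t + degree f)"
        by (intro order.trans[OF degree_mult_le] add_mono) (auto simp: degree_monom_eq p(1)[symmetric] degree_mult_le)
      then have "degree (monom 1 i * (p * f)) < n" using that by simp
      from sum_lagrange_weights[OF b this] show ?thesis
        by (simp add: z_def poly_monom mult_ac)
    qed
    have ext: "(if k - 1 - i < s then \<gamma> (k - 1 - i) * coeff f i else 0) = of_bool (i = k - 1) * coeff f i"
      if "i < k" for i
      using that s by (auto simp: \<gamma>_def)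
    show "(\<forall>i<k. (\<Sum>j<n. z j * poly f (b j) * b j ^ i) + (if k - 1 - i < s then \<gamma> (k - 1 - i) * coeff f i else 0) = 0)
      \<longleftrightarrow> f \<in> polys_below (k - R)" (is "?lhs \<longleftrightarrow> _")
    proof
      assume "f \<in> polys_below (k - R)"
      show ?lhs
      proof (cases "f = 0")
        case True
        then show ?thesis by simp
      next
        case False
        then have deg: "degree f < k - R"
          using \<open>f \<in> polys_below (k - R)\<close> unfolding polys_below_def
          by (metis (mono_tags) leading_coeff_0_iff mem_Collect_eq not_le)
        show ?thesis
        proof (intro allI impI)
          fix i assume i: "i < k"
          \<comment> \<open>The sum is at most \<open>(k - 1) + t + (k - R - 1) = n - 2\<close>, one
            short of the position read off.\<close>
          have lt: "i + t + degree f < n - 1" using deg i t R by linarith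
          have "degree (monom 1 i * (p * f)) \<le> i + (t + degree f)"
            by (intro order.trans[OF degree_mult_le] add_mono) (auto simp: degree_monom_eq p(1)[symmetric] degree_mult_le)
          then have "coeff (monom 1 i * (p * f)) (n - 1) = 0" using lt by (intro coeff_eq_0) simp
          moreover have "coeff f (k - 1) = 0" using deg R by (intro coeff_eq_0) simp
          ultimately show "(\<Sum>j<n. z j * poly f (b j) * b j ^ i) + (if k - 1 - i < s then \<gamma> (k - 1 - i) * coeff f i else 0) = 0"
            unfolding ext[OF i] using sum[of i] lt by auto
        qed
      qed
    next
      assume lhs: ?lhs
      show "f \<in> polys_below (k - R)"
      proof (rule ccontr)
        assume nf: "f \<notin> polys_below (k - R)"
        then have f0: "f \<noteq> 0" by (auto simp: polys_below_def)
        have deg: "k - R \<le> degree f" "degree f < k"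
          using nf polys_below_degree[OF f] hk by (auto simp: polys_below_def dest: le_degree)
        \<comment> \<open>Testing against \<open>x\<^sup>i\<close> puts the leading coefficient of \<open>x\<^sup>i p f\<close> in position \<open>n - 1\<close>.\<close>
        define i where "i = n - 1 - t - degree f"
        have i: "i < k" "i + t + degree f = n - 1" "0 < n" using deg t hk R by (auto simp: i_def)
        have p0: "p \<noteq> 0" using p(2)[of 0] by auto
        have "degree (monom 1 i * (p * f)) = n - 1"
          using f0 p0 p(1) i by (simp add: degree_mult_eq degree_monom_eq)
        moreover have "monom 1 i * (p * f) \<noteq> 0" using f0 p0 by simp
        ultimately have "coeff (monom 1 i * (p * f)) (n - 1) \<noteq> 0" by (metis leading_coeff_0_iff)
        \<comment> \<open>If \<open>i = k - 1\<close>, then \<open>degree f = k - R\<close>, which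
          is below \<open>k - 1\<close>, so the extension term does not interfere.\<close>
        moreover have "of_bool (i = k - 1) * coeff f i = 0"
          using coeff_eq_0[of f i] i deg t R by auto
        moreover have "(\<Sum>j<n. z j * poly f (b j) * b j ^ i) = coeff (monom 1 i * (p * f)) (n - 1)"
          using i by (intro sum) simp
        ultimately show False using lhs[rule_format, OF i(1)] unfolding ext[OF i(1)] by (metis add.right_neutral)
      qed
    qed
  qed (use hk R in auto)
qed

text \<open>Up to \<open>R = s\<close> the extension weights supply the rank; beyond that
  \<open>2 \<le> s\<close> gives \<open>3 \<le> R\<close>, the range covered by the rootless
  polynomial.\<close>

lemma exists_EAQECC:
  fixes b :: "nat \<Rightarrow> 'a::{field,finite}"
  assumes "2 < CARD('a)" "inj_on b {..<n}" "2 \<le> k" "2 * k \<le> n + 1" "2 \<le> s" "1 \<le> R" "R \<le> k"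
  shows "\<exists>d\<ge>n - k + 2. EAQECC_exists CARD('a) (n + s) R d (n + s + R - 2 * k)"
proof (cases "R \<le> s")
  case True
  then show ?thesis using assms exists_EAQECC_small_rank by blast
next
  case False
  then show ?thesis using assms exists_EAQECC_large_rank[of b n k s R] by simp
qed

section \<open>Reduction of the four parameter families to one rate bound\<close>

theorem mainTheorem18:
  fixes p e l q n k s :: nat
    and F :: "'a::{field,finite} set"
    and a u :: "nat \<Rightarrow> 'a"
  assumes "prime p" and "q = p ^ e" and "q > 4" and "CARD('a) = q"
    and "l > 0" and "2 * l dvd e"
    and "is_subfield F" and "card F = p ^ l"
    and "inj_on a {1..n}"
    and "\<forall>j\<in>{1..n}. u j = (\<Prod>v\<in>{1..n} - {j}. inverse (a j - a v))"
    and "2 \<le> s" and "s < k" and "k \<le> n"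
  shows
    "((\<forall>j\<in>{1..n}. a j \<noteq> 0 \<and> inverse (a j) * u j \<in> F - {0}) \<longrightarrow>
       int k \<le> \<lfloor>(real n + real (p ^ l)) / (real (p ^ l) + 1)\<rfloor> \<longrightarrow>
       (\<forall>h. h \<le> k - s - 1 \<longrightarrow>
         (\<exists>d \<ge> n - k + 2. EAQECC_exists q (n + s) (k - h) d (n + s - k - h))))
   \<and> (\<forall>\<delta>::nat. \<forall>\<mu>::'a. \<delta> > 0 \<longrightarrow> \<mu> \<noteq> 0 \<longrightarrow>
       (\<forall>j\<in>{1..n}. \<mu> * a j ^ (\<delta> - 1) * u j \<in> F - {0}) \<longrightarrow>
       int k \<le> \<lfloor>(real n + real (p ^ l) - real \<delta> + 1) / (real (p ^ l) + 1)\<rfloor> \<longrightarrow>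
       (\<forall>h. h \<le> k - s \<longrightarrow>
         (\<exists>d \<ge> n - k + 2. EAQECC_exists q (n + s) (k - h) d (n + s - k - h))))
   \<and> (\<forall>\<xi>::nat. (\<forall>j\<in>{1..n}. a j \<noteq> 0 \<and> inverse (a j) * u j \<in> F - {0}) \<longrightarrow>
       n > 0 \<longrightarrow> (p ^ l + 1) dvd n \<longrightarrow>
       k = \<xi> + 1 + n div (p ^ l + 1) \<longrightarrow>
       int \<xi> \<le> min (int (p ^ l) - 1) \<lfloor>(real n / (real (p ^ l) + 1) - 1) / real (p ^ l)\<rfloor> \<longrightarrow>
       \<xi> + 1 \<le> s \<longrightarrow> s \<le> min (\<xi> + p ^ l) (k - 1) \<longrightarrow>
       (\<exists>d \<ge> n - k + 2. EAQECC_exists q (n + s) s d (n + 2 * s - 2 * k)))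
   \<and> (\<forall>\<delta>::nat. \<forall>\<mu>::'a. \<forall>\<xi>::nat. \<delta> > 0 \<longrightarrow> \<mu> \<in> F - {0} \<longrightarrow>
       (\<forall>j\<in>{1..n}. \<mu> * a j ^ (\<delta> - 1) * u j \<in> F - {0}) \<longrightarrow>
       \<delta> < n \<longrightarrow> (p ^ l + 1) dvd (n - \<delta>) \<longrightarrow>
       k = \<xi> + 1 + (n - \<delta>) div (p ^ l + 1) \<longrightarrow>
       int \<xi> \<le> min (int (p ^ l) - 1)
                  \<lfloor>(real n - real \<delta>) / (real (p ^ l) * (real (p ^ l) + 1))\<rfloor> \<longrightarrow>
       \<xi> + 1 \<le> s \<longrightarrow> s \<le> min (\<xi> + p ^ l) (k - 1) \<longrightarrow>
       (\<exists>d \<ge> n - k + 2. EAQECC_exists q (n + s) (s - 1) d (n + 2 * s - 2 * k - 1)))"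
proof -
  define Q where "Q = p ^ l"
  have "p \<le> Q" unfolding Q_def using \<open>l > 0\<close> prime_ge_1_nat[OF \<open>prime p\<close>] by (intro self_le_power)
  then have Q: "2 \<le> Q" using prime_ge_2_nat[OF \<open>prime p\<close>] by simp
  have b: "inj_on (\<lambda>j. a (j + 1)) {..<n}"
  proof (rule inj_onI)
    fix i j assume "i \<in> {..<n}" "j \<in> {..<n}" "a (i + 1) = a (j + 1)"
    then show "i = j" using inj_onD[OF \<open>inj_on a {1..n}\<close>, of "i + 1" "j + 1"] by simp
  qed
  have key: "\<exists>d\<ge>n - k + 2. EAQECC_exists q (n + s) R d c"
    if "2 * k \<le> n + 1" "1 \<le> R" "R \<le> k" "c = n + s + R - 2 * k" for R c
  proof -
    have card: "CARD('a) = q" by fact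
    have "2 < CARD('a)" "2 \<le> k" using assms(3,11,12) card by linarith+
    from exists_EAQECC[OF this(1) b this(2) that(1) \<open>2 \<le> s\<close> that(2,3)]
    show ?thesis unfolding card that(4) .
  qed
  \<comment> \<open>Writing \<open>k = k' + 1\<close>, \<open>2 \<le> Q\<close> turns the inequality
    into \<open>3 * k' + 1 \<le> n\<close>.\<close>
  have rate: "2 * k \<le> n + 1" if "real k * (real Q + 1) \<le> real n + real Q"
  proof -
    have "real (k * (Q + 1)) \<le> real (n + Q)" using that by (simp add: algebra_simps)
    then have "k * (Q + 1) \<le> n + Q" by (simp only: of_nat_le_iff)
    moreover obtain k' where k': "k = Suc k'" using \<open>s < k\<close> by (cases k) auto
    moreover obtain Q' where "Q = Q' + 2" using Q by (metis add.commute le_Suc_ex)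
    ultimately have "3 * k' + 1 \<le> n" by (simp add: algebra_simps)
    then show ?thesis using k' assms(11,12) by simp
  qed
  \<comment> \<open>From \<open>2 \<le> Q\<close> follows \<open>3 * m \<le> n\<close>. In the first
    case \<open>2 * k\<close> is at most \<open>3 * m + 1\<close>, in the second at most
    \<open>3 * m + 2\<close> with \<open>3 * m < n\<close>.\<close>
  have rate_\<xi>: "2 * k \<le> n + 1"
    if "k = \<xi> + 1 + m" "m * (Q + 1) \<le> n" "2 * \<xi> + 1 \<le> m \<or> 2 * \<xi> \<le> m \<and> m * (Q + 1) < n" for \<xi> m
  proof -
    obtain Q' where "Q = Q' + 2" using Q by (metis add.commute le_Suc_ex)
    then show ?thesis using that by (auto simp: algebra_simps)
  qed
  \<comment> \<open>\<open>x\<close> stands for the numerator of either of the first two families;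
    \<open>0 < \<delta>\<close> keeps the second one at most \<open>n + Q\<close>.\<close>
  have P1: "\<exists>d\<ge>n - k + 2. EAQECC_exists q (n + s) (k - h) d (n + s - k - h)"
    if "int k \<le> \<lfloor>x / (real Q + 1)\<rfloor>" "x \<le> real n + real Q" "h \<le> k - s" for h x
  proof (rule key)
    have "real k \<le> x / (real Q + 1)" using that(1) by (simp add: le_floor_iff)
    then have "real k * (real Q + 1) \<le> x" by (simp add: pos_le_divide_eq add_nonneg_pos)
    then show "2 * k \<le> n + 1" using that(2) by (intro rate) simp
  qed (use that(3) assms(11,12) in auto)
  have P3: "\<exists>d\<ge>n - k + 2. EAQECC_exists q (n + s) s d (n + 2 * s - 2 * k)"
    if "(Q + 1) dvd n" "k = \<xi> + 1 + n div (Q + 1)"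
      "int \<xi> \<le> \<lfloor>(real n / (real Q + 1) - 1) / real Q\<rfloor>" for \<xi>
  proof (rule key)
    define m where "m = n div (Q + 1)"
    have n: "n = m * (Q + 1)" unfolding m_def by (rule dvd_div_mult_self[OF that(1), symmetric])
    have "real n / (real Q + 1) = real m" by (subst n) (simp add: field_simps add_nonneg_eq_0_iff)
    moreover have "real \<xi> \<le> (real n / (real Q + 1) - 1) / real Q" using that(3) by (simp add: le_floor_iff)
    ultimately have "real \<xi> * real Q + 1 \<le> real m" using Q by (simp add: pos_le_divide_eq)
    then have "real (\<xi> * Q + 1) \<le> real m" by simp
    then have "\<xi> * Q + 1 \<le> m" by (simp only: of_nat_le_iff)
    then have "2 * \<xi> + 1 \<le> m" using mult_le_mono2[OF Q, of \<xi>] by linarith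
    moreover have "k = \<xi> + 1 + m" unfolding m_def by (rule that(2))
    ultimately show "2 * k \<le> n + 1" using eq_refl[OF n[symmetric]] by (intro rate_\<xi>[of \<xi> m]) simp_all
  qed (use assms(11,12) in auto)
  have P4: "\<exists>d\<ge>n - k + 2. EAQECC_exists q (n + s) (s - 1) d (n + 2 * s - 2 * k - 1)"
    if "0 < \<delta>" "\<delta> < n" "(Q + 1) dvd (n - \<delta>)" "k = \<xi> + 1 + (n - \<delta>) div (Q + 1)"
      "int \<xi> \<le> \<lfloor>(real n - real \<delta>) / (real Q * (real Q + 1))\<rfloor>" for \<delta> \<xi>
  proof (rule key)
    define m where "m = (n - \<delta>) div (Q + 1)"
    have n: "n - \<delta> = m * (Q + 1)" unfolding m_def by (rule dvd_div_mult_self[OF that(3), symmetric])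
    have "real n - real \<delta> = real (n - \<delta>)" using that(2) by simp
    also have "\<dots> = real m * (real Q + 1)" unfolding n by (simp add: algebra_simps)
    finally have "(real n - real \<delta>) / (real Q * (real Q + 1)) = real m / real Q" by simp
    moreover have "real \<xi> \<le> (real n - real \<delta>) / (real Q * (real Q + 1))" using that(5) by (simp add: le_floor_iff)
    ultimately have "real \<xi> * real Q \<le> real m" using Q by (simp add: pos_le_divide_eq)
    then have "real (\<xi> * Q) \<le> real m" by simp
    then have "\<xi> * Q \<le> m" by (simp only: of_nat_le_iff)
    then have "2 * \<xi> \<le> m" using mult_le_mono2[OF Q, of \<xi>] by linarith
    moreover have "k = \<xi> + 1 + m" unfolding m_def by (rule that(4))
    \<comment> \<open>Positive \<open>\<delta>\<close> makes this strict, which pays for the weaker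
      bound \<open>2 * \<xi> \<le> m\<close>.\<close>
    moreover have "m * (Q + 1) < n" using n that(1,2) by linarith
    ultimately show "2 * k \<le> n + 1" by (intro rate_\<xi>[of \<xi> m]) simp_all
  qed (use assms(11,12) in auto)
  show ?thesis
    unfolding Q_def[symmetric]
  proof (intro conjI allI impI, goal_cases)
    case (1 h)
    then show ?case by (intro P1[of "real n + real Q"]) auto
  next
    case (2 \<delta> \<mu> h)
    then show ?case by (intro P1[of "real n + real Q - real \<delta> + 1"]) auto
  next
    case (3 \<xi>)
    then show ?case by (intro P3[of \<xi>]) auto
  next
    case (4 \<delta> \<mu> \<xi>)
    then show ?case by (intro P4[of \<delta> \<xi>]) auto
  qed
qed

end
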